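(* Let $p$ be a positive integer. Let $\mathcal{P}^p\subseteq \operatorname{QSym}$ be the algebra of $p$-extended peaks, i.e. the subalgebra of $\operatorname{QSym}$ that is the $\mathbb{C}$-linear span of all the quasisymmetric functions $L^p_{n,I}$ with $n\ge 0$ and $I\subseteq[n-1]$ (so, in particular, this span is closed under multiplication). Then the family $(L^p_{n,I})_{n\ge 0,\ I\subseteq_p[n-1]}$, indexed by all pairs $(n,I)$ with $n\geq 0$ and $I$ a $p$-extended peak subset of $[n-1]$, is a basis of $\mathcal{P}^p$ as a $\mathbb{C}$-vector space.
   Context: Notation: $[n]=\{1,2,\dots,n\}$, and $[0]=[-1]=\emptyset$. $\operatorname{QSym}$ is the $\mathbb{C}$-algebra of quasisymmetric functions in the commuting variables $x_1,x_2,x_3,\dots$ (a subalgebra of $\mathbb{C}[[x_1,x_2,\dots]]$). $q$-fundamental quasisymmetric functions: let $\mathbb{P}^{\pm}$ be the set of nonzero integers totally ordered by $-1<1<-2<2<-3<3<\cdots$. For $n\ge 0$, $I\subseteq[n-1]$ and $q\in\mathbb{C}$, the function $L^{(q)}_{n,I}$ is $$L^{(q)}_{n,I}=\sum_{(g_1,\dots,g_n)} q^{|\{j\in[n]\,:\,g_j<0 \text{ as an integer}\}|}\,x_{|g_1|}x_{|g_2|}\cdots x_{|g_n|},$$ where the sum is over all sequences $(g_1,\dots,g_n)$ of elements of $\mathbb{P}^{\pm}$ with $g_1\le g_2\le\dots\le g_n$ (in the total order $-1<1<-2<2<-3<3<\cdots$ on $\mathbb{P}^{\pm}$) such that for each $j\in[n-1]$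 with $g_j=g_{j+1}$, the common value is a positive integer if $j\notin I$ and a negative integer if $j\in I$. Equivalently, $$L^{(q)}_{n,I}=\sum_{\substack{i_1\le i_2\le\dots\le i_n\\ j\in \operatorname{Peak}(I)\Rightarrow i_{j-1}<i_{j+1}}} q^{|\{j\in I\,:\, i_j=i_{j+1}\}|}(q+1)^{|\{i_1,\dots,i_n\}|}x_{i_1}x_{i_2}\cdots x_{i_n},$$ where the $i_j$ are positive integers and $\operatorname{Peak}(I)=\{j\in I: j\ge 2,\ j-1\notin I\}$. For $n=0$, $L^{(q)}_{0,\emptyset}=1$. Extended peak functions: for a positive integer $p$ let $\rho_p=e^{-\mathrm{i}\pi(p-1)/(p+1)}$ (where $\mathrm{i}^2=-1$), so that $-\rho_p$ is a primitive $(p+1)$-th root of unity. Put $L^p_{n,I}=L^{(\rho_p)}_{n,I}$. Extended peak sets: a set $I\subseteq[n-1]$ is a $p$-extended peak set, written $I\subseteq_p[n-1]$, if $I\cup\{0\}$ does not contain more than $p$ consecutive integers (i.e. contains no set of $p+1$ consecutive integers). *)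

theory Defs
  imports Complex_Main "HOL-Library.Multiset"
begin

section \<open>Formal power series in countably many commuting variables\<close>

text \<open>
  The ring \<open>\<complex>[[x\<^sub>1, x\<^sub>2, x\<^sub>3, \<dots>]]\<close>. A monomial is the multiset of the indices of its
  variables, with multiplicity, and a power series is its family of coefficients. The variables
  are numbered from \<open>1\<close>, hence no monomial containing the index \<open>0\<close> occurs.
\<close>

typedef power_series = "{f :: nat multiset \<Rightarrow> complex. \<forall>M. 0 \<in># M \<longrightarrow> f M = 0}"
  morphisms coeff Abs_power_series
  by (rule exI[of _ "\<lambda>_. 0"]) simp

setup_lifting type_definition_power_series

lemma coeff_eqI: "(\<And>M. coeff f M = coeff g M) \<Longrightarrow> f = g"
  by (metis coeff_inject ext)

lemma coeff_zero_index: "0 \<in># M \<Longrightarrow> coeff f M = 0"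
  using coeff[of f] by simp

definition splits :: "nat multiset \<Rightarrow> (nat multiset \<times> nat multiset) set" where
  "splits M = {(A, B). A + B = M}"

lemma finite_splits: "finite (splits M)"
proof -
  have sub: "{A. A \<subseteq># M} \<subseteq> mset ` {ys. set ys \<subseteq> set_mset M \<and> length ys \<le> size M}"
  proof
    fix A assume A: "A \<in> {A. A \<subseteq># M}"
    obtain ys where ys: "mset ys = A" using ex_mset by blast
    have "set ys \<subseteq> set_mset M" "length ys \<le> size M"
      using A ys set_mset_mono[of A M] size_mset_mono[of A M] by auto
    then show "A \<in> mset ` {ys. set ys \<subseteq> set_mset M \<and> length ys \<le> size M}"
      using ys by blast
  qed
  have "finite {A. A \<subseteq># M}"
    by (rule finite_subset[OF sub]) (intro finite_imageI finite_lists_length_le, simp)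
  moreover have "splits M \<subseteq> {A. A \<subseteq># M} \<times> {A. A \<subseteq># M}"
    by (auto simp: splits_def)
  ultimately show ?thesis
    by (meson finite_SigmaI finite_subset)
qed

instantiation power_series :: comm_ring_1
begin

lift_definition zero_power_series :: power_series is "\<lambda>_. 0" by simp

lift_definition one_power_series :: power_series is "\<lambda>M. if M = {#} then 1 else 0" by auto

lift_definition plus_power_series :: "power_series \<Rightarrow> power_series \<Rightarrow> power_series"
  is "\<lambda>f g M. f M + g M" by simp

lift_definition uminus_power_series :: "power_series \<Rightarrow> power_series"
  is "\<lambda>f M. - f M" by simp

lift_definition minus_power_series :: "power_series \<Rightarrow> power_series \<Rightarrow> power_series"
  is "\<lambda>f g M. f M - g M" by simp

lift_definition times_power_series :: "power_series \<Rightarrow> power_series \<Rightarrow> power_series"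
  is "\<lambda>f g M. \<Sum>(A, B)\<in>splits M. f A * g B"
  by (rule sum.neutral) (auto simp: splits_def)

instance
proof
  fix f g h :: power_series
  show "f + g + h = f + (g + h)" by transfer (simp add: add.assoc)
  show "f + g = g + f" by transfer (simp add: add.commute)
  show "0 + f = f" by transfer simp
  show "- f + f = 0" by transfer simp
  show "f - g = f + - g" by transfer simp
  show "(0::power_series) \<noteq> 1"
    by transfer (metis zero_neq_one)
  show "(f + g) * h = f * h + g * h"
    by transfer (simp add: distrib_right sum.distrib split_def)
  show "f * g = g * f"
  proof (rule coeff_eqI)
    fix M
    show "coeff (f * g) M = coeff (g * f) M"
      unfolding times_power_series.rep_eq
      by (rule sum.reindex_bij_witness[of _ prod.swap prod.swap])
        (auto simp: splits_def ac_simps)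
  qed
  show "1 * f = f"
  proof (rule coeff_eqI)
    fix M
    have "coeff (1 * f) M = (\<Sum>p\<in>splits M. if p = ({#}, M) then coeff f M else 0)"
      unfolding times_power_series.rep_eq one_power_series.rep_eq
      by (rule sum.cong) (auto simp: splits_def split: if_splits)
    also have "\<dots> = coeff f M"
      by (subst sum.delta[OF finite_splits]) (auto simp: splits_def)
    finally show "coeff (1 * f) M = coeff f M" .
  qed
  show "f * g * h = f * (g * h)"
  proof (rule coeff_eqI)
    fix M
    have "coeff (f * g * h) M =
        (\<Sum>(p, q)\<in>(SIGMA p:splits M. splits (fst p)). coeff f (fst q) * coeff g (snd q) * coeff h (snd p))"
      unfolding times_power_series.rep_eq
      by (simp add: split_def sum_distrib_right sum.Sigma finite_splits)
    also have "\<dots> =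
        (\<Sum>(p, q)\<in>(SIGMA p:splits M. splits (snd p)). coeff f (fst p) * (coeff g (fst q) * coeff h (snd q)))"
      by (rule sum.reindex_bij_witness[of _
            "\<lambda>((a, b), (c, d)). ((a + c, d), (a, c))" "\<lambda>((a, b), (c, d)). ((c, d + b), (d, b))"])
        (auto simp: splits_def ac_simps)
    also have "\<dots> = coeff (f * (g * h)) M"
      unfolding times_power_series.rep_eq
      by (simp add: split_def sum_distrib_left sum.Sigma finite_splits)
    finally show "coeff (f * g * h) M = coeff (f * (g * h)) M" .
  qed
qed

end

lift_definition scale :: "complex \<Rightarrow> power_series \<Rightarrow> power_series" is "\<lambda>c f M. c * f M" by simp

interpretation PS: vector_space scale
  by unfold_locales (transfer; simp add: algebra_simps)+

definition is_subalgebra :: "power_series set \<Rightarrow> bool" where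
  "is_subalgebra A \<longleftrightarrow> PS.subspace A \<and> 1 \<in> A \<and> (\<forall>f\<in>A. \<forall>g\<in>A. f * g \<in> A)"

text \<open>Injectivity is what makes this a statement about the family and not just about its range.\<close>

definition is_basis_family :: "('i \<Rightarrow> power_series) \<Rightarrow> 'i set \<Rightarrow> power_series set \<Rightarrow> bool" where
  "is_basis_family F S V \<longleftrightarrow> inj_on F S \<and> PS.independent (F ` S) \<and> PS.span (F ` S) = V"


section \<open>Quasisymmetric functions\<close>

text \<open>\<open>monom_of [i\<^sub>1, \<dots>, i\<^sub>k] [a\<^sub>1, \<dots>, a\<^sub>k]\<close> is the monomial \<open>x\<^bsub>i\<^sub>1\<^esub>\<^bsup>a\<^sub>1\<^esup> \<cdots> x\<^bsub>i\<^sub>k\<^esub>\<^bsup>a\<^sub>k\<^esup>\<close>.\<close>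

definition monom_of :: "nat list \<Rightarrow> nat list \<Rightarrow> nat multiset" where
  "monom_of is as = sum_list (map2 (\<lambda>i a. replicate_mset a i) is as)"

definition QSym :: "power_series set" where
  "QSym = {f.
     (\<exists>d. \<forall>M. coeff f M \<noteq> 0 \<longrightarrow> size M \<le> d) \<and>
     (\<forall>is js as. length is = length as \<and> length js = length as \<and>
        sorted_wrt (<) is \<and> sorted_wrt (<) js \<and> 0 \<notin> set is \<and> 0 \<notin> set js \<and> 0 \<notin> set as \<longrightarrow>
        coeff f (monom_of is as) = coeff f (monom_of js as))}"


section \<open>$q$-fundamental quasisymmetric functions\<close>

text \<open>The total order \<open>-1 < 1 < -2 < 2 < -3 < 3 < \<cdots>\<close> on the nonzero integers.\<close>

definition pm_le :: "int \<Rightarrow> int \<Rightarrow> bool" where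
  "pm_le a b \<longleftrightarrow> \<bar>a\<bar> < \<bar>b\<bar> \<or> (\<bar>a\<bar> = \<bar>b\<bar> \<and> a \<le> b)"

text \<open>
  The sequences \<open>(g\<^sub>1, \<dots>, g\<^sub>n)\<close> that \<open>L\<^bsub>n,I\<^esub>\<^bsup>(q)\<^esup>\<close> sums over; lists are indexed from \<open>0\<close>, so
  \<open>g\<^sub>j\<close> is \<open>g ! (j - 1)\<close>.
\<close>

definition enriched :: "nat \<Rightarrow> nat set \<Rightarrow> int list set" where
  "enriched n I = {g. length g = n \<and> 0 \<notin> set g \<and> sorted_wrt pm_le g \<and>
     (\<forall>j\<in>{1..<n}. g ! (j - 1) = g ! j \<longrightarrow>
        (j \<notin> I \<longrightarrow> g ! j > 0) \<and> (j \<in> I \<longrightarrow> g ! j < 0))}"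

definition monom_of_seq :: "int list \<Rightarrow> nat multiset" where
  "monom_of_seq g = mset (map (\<lambda>a. nat \<bar>a\<bar>) g)"

text \<open>The sums below have only finitely many terms.\<close>

lemma finite_enriched_monom: "finite {g \<in> enriched n I. monom_of_seq g = M}"
proof (rule finite_subset)
  show "{g \<in> enriched n I. monom_of_seq g = M}
      \<subseteq> {g. set g \<subseteq> int ` set_mset M \<union> uminus ` int ` set_mset M \<and> length g = n}"
  proof safe
    fix g a assume g: "g \<in> enriched n I" "M = monom_of_seq g" and a: "a \<in> set g"
      and nin: "a \<notin> uminus ` int ` set_mset (monom_of_seq g)"
    have mem: "nat \<bar>a\<bar> \<in># monom_of_seq g" using a by (auto simp: monom_of_seq_def)
    show "a \<in> int ` set_mset (monom_of_seq g)"
    proof (cases "a \<ge> 0")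
      case True then show ?thesis using mem by (intro image_eqI[of _ _ "nat \<bar>a\<bar>"]) auto
    next
      case False
      then have "a = - int (nat \<bar>a\<bar>)" by simp
      then show ?thesis using mem nin by blast
    qed
  qed (auto simp: enriched_def)
qed (intro finite_lists_length_eq finite_UnI finite_imageI finite_set_mset)

lift_definition qfund :: "complex \<Rightarrow> nat \<Rightarrow> nat set \<Rightarrow> power_series" is
  "\<lambda>q n I M. \<Sum>g | g \<in> enriched n I \<and> monom_of_seq g = M. q ^ card {j\<in>{1..n}. g ! (j - 1) < 0}"
  by (rule sum.neutral) (auto simp: enriched_def monom_of_seq_def)

lemma qfund_0: "qfund q 0 {} = 1"
proof (rule coeff_eqI)
  fix M
  have "{g. g \<in> enriched 0 {} \<and> monom_of_seq g = M} = (if M = {#} then {[]} else {})"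
    by (auto simp: enriched_def monom_of_seq_def)
  then show "coeff (qfund q 0 {}) M = coeff 1 M"
    by (simp add: qfund.rep_eq one_power_series.rep_eq)
qed


section \<open>Extended peaks\<close>

definition rho :: "nat \<Rightarrow> complex" where
  "rho p = exp (- \<i> * of_real pi * (of_nat p - 1) / (of_nat p + 1))"

definition ext_peak_fun :: "nat \<Rightarrow> nat \<Rightarrow> nat set \<Rightarrow> power_series" where
  "ext_peak_fun p n I = qfund (rho p) n I"

text \<open>\<open>{1..<n}\<close> is the set \<open>[n - 1]\<close>, also for \<open>n = 0\<close>, where it is empty.\<close>

definition ext_peak_set :: "nat \<Rightarrow> nat \<Rightarrow> nat set \<Rightarrow> bool" where
  "ext_peak_set p n I \<longleftrightarrow> I \<subseteq> {1..<n} \<and> \<not> (\<exists>k. {k..k + p} \<subseteq> I \<union> {0})"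

definition ext_peak_algebra :: "nat \<Rightarrow> power_series set" where
  "ext_peak_algebra p = PS.span {ext_peak_fun p n I | n I. I \<subseteq> {1..<n}}"

end

theory Submission
  imports Defs
begin

text \<open>
  Everything rests on one factorisation. Write \<open>L\<^sub>n\<^sub>,\<^sub>I\<close> for \<open>qfund q n I\<close>, and call a maximal run
  of entries of equal absolute value in a sequence a block. The coefficient of a monomial in
  \<open>L\<^sub>n\<^sub>,\<^sub>I\<close> is a product over its variables, because the blocks of a sequence can be chosen
  independently of each other. Splitting off the last variable (\<open>coeff_qfund_block\<close>) therefore
  expresses coefficients of \<open>L\<^sub>n\<^sub>,\<^sub>I\<close> by those of \<open>L\<^sub>s\<^sub>,\<^sub>I\<close> with \<open>s < n\<close>, and every part of the
  theorem is proved by induction along this recursion. Quasisymmetry is immediate, as the factors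
  depend on the exponents only.

  \<^emph>\<open>Products.\<close> Attach to a word with descent set \<open>I\<close> the function \<open>L\<^sub>n\<^sub>,\<^sub>I\<close>. Then the product of
  the functions of two words without common letters is the sum over their shuffles
  (\<open>word_qfund_mult\<close>). The reason is that the weight of a block is a character for the shuffle
  product, being a convolution of the indicators of decreasing and of increasing words.

  \<^emph>\<open>Spanning.\<close> Suppose that \<open>k\<close> lies in \<open>I\<close> or is \<open>0\<close>, that \<open>k + p < n\<close>, and that none of \<open>k + 1,
  \<dots>, k + p + 1\<close> lies in \<open>I\<close>. Then the alternating sum of \<open>L\<^sub>n\<^sub>,\<^sub>I\<^sub>\<union>\<^sub>Y\<close> over all subsets \<open>Y\<close> of \<open>{k
  + 1, \<dots>, k + p}\<close> is zero (\<open>run_relation\<close>). If the entries of a sequence at \<open>k + 1, \<dots>, k + p + 1\<close>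
  are not all equal, the sets \<open>Y\<close> for which it is admissible come in pairs of opposite sign. If
  they are all equal, changing their common sign gives another admissible sequence; the two
  weights differ by \<open>q\<^sup>p\<^sup>+\<^sup>1\<close> and the two signs by \<open>(-1)\<^sup>p\<close>, so they cancel since \<open>(- q)\<^sup>p\<^sup>+\<^sup>1 =
  1\<close>. The relation expresses the function of a set that is not an extended peak set by those of
  proper subsets.

  \<^emph>\<open>Independence.\<close> Let \<open>a I\<close> be the coefficients of a linear relation in degree \<open>n\<close>, with \<open>a I =
  0\<close> if \<open>I\<close> is not an extended peak set. Extracting a power of the last variable yields relations
  in smaller degrees, whose coefficients vanish by induction. These equations can be solved
  explicitly: if all elements of \<open>P\<close> are smaller than \<open>s\<close>, and \<open>n - s\<close> is not a multiple of \<open>p +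
  1\<close>, then \<open>a (insert s P) = - a P\<close> (\<open>toggle_top\<close>; primitivity of the root of unity enters here).
  Such toggles lead from any set to one that is not an extended peak set, where \<open>a\<close> is zero
  (\<open>vanish_if_supported_on_ext_peak_sets\<close>).
\<close>

section \<open>Splitting off the last variable\<close>

text \<open>
  A \<^emph>\<open>block\<close> of a sequence is a maximal run of entries with the same absolute value; if it occupies
  the positions \<open>s + 1, \<dots>, s + a\<close>, it consists of \<open>b\<close> negative entries followed by \<open>a - b\<close>
  positive ones. The predicate says which \<open>b\<close> the set \<open>I\<close> admits. The change of sign makes the
  index \<open>s + b\<close> free, and the index \<open>s\<close> in front of the block is free as well.
\<close>

definition fits :: "nat set \<Rightarrow> nat \<Rightarrow> nat \<Rightarrow> nat \<Rightarrow> bool" where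
  "fits I s a b \<longleftrightarrow> (\<forall>i\<in>{1..<b}. s + i \<in> I) \<and> (\<forall>i\<in>{b<..<a}. s + i \<notin> I)"

definition block_weight :: "complex \<Rightarrow> nat set \<Rightarrow> nat \<Rightarrow> nat \<Rightarrow> complex" where
  "block_weight q I s a = (\<Sum>b | b \<le> a \<and> fits I s a b. q ^ b)"

definition block :: "nat \<Rightarrow> nat \<Rightarrow> nat \<Rightarrow> int list" where
  "block N a b = replicate b (- int N) @ replicate (a - b) (int N)"

lemma length_block: "b \<le> a \<Longrightarrow> length (block N a b) = a"
  by (simp add: block_def)

lemma nth_block: "b \<le> a \<Longrightarrow> i < a \<Longrightarrow> block N a b ! i = (if i < b then - int N else int N)"
  by (simp add: block_def nth_append)

lemma sorted_block:
  assumes "sorted_wrt pm_le h" "\<forall>x\<in>set h. nat \<bar>x\<bar> = N" "length h = a"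
  shows "\<exists>b\<le>a. h = block N a b"
  using assms
proof (induction h arbitrary: a)
  case Nil
  then show ?case by (auto simp: block_def)
next
  case (Cons x h)
  then obtain b where b: "b \<le> length h" "h = block N (length h) b"
    by fastforce
  have x: "x = int N \<or> x = - int N" using Cons.prems by auto
  have a: "a = Suc (length h)" using Cons.prems by simp
  show ?case
  proof (cases "x = - int N")
    case True
    then have "x # h = block N a (Suc b)"
      using b a unfolding block_def by (metis append_Cons diff_Suc_Suc replicate_Suc)
    then show ?thesis using b a by (intro exI[of _ "Suc b"]) auto
  next
    case False
    then have x: "x = int N" "N > 0" using x by (auto intro: gr0I)
    have "b = 0"
    proof (rule ccontr)
      assume "b \<noteq> 0"
      then have "- int N \<in> set h" using b by (metis UnCI block_def in_set_replicate set_append)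
      then show False using Cons.prems x by (auto simp: pm_le_def)
    qed
    then have "x # h = block N a 0" using b a x unfolding block_def by simp
    then show ?thesis by blast
  qed
qed

lemma pm_le_abs: "pm_le a b \<Longrightarrow> nat \<bar>a\<bar> \<le> nat \<bar>b\<bar>"
  by (auto simp: pm_le_def)

lemma enriched_append_block:
  assumes N: "N > 0" and b: "b \<le> a" and g: "\<forall>x\<in>set g. nat \<bar>x\<bar> < N" and len: "length g = s"
  shows "g @ block N a b \<in> enriched (s + a) I \<longleftrightarrow>
    g \<in> enriched s I \<and> fits I s a b"
    (is "?h \<in> _ \<longleftrightarrow> _")
proof -
  have set_block: "set (block N a b) \<subseteq> {int N, - int N}"
    by (auto simp: block_def)
  have sorted: "sorted_wrt pm_le ?h \<longleftrightarrow> sorted_wrt pm_le g"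
  proof -
    have "sorted_wrt pm_le (block N a b)"
      using N b by (subst sorted_wrt_iff_nth_less) (auto simp: length_block nth_block pm_le_def)
    moreover have "pm_le x y" if "x \<in> set g" "y \<in> set (block N a b)" for x y
      using that g set_block by (fastforce simp: pm_le_def)
    ultimately show ?thesis by (auto simp: sorted_wrt_append)
  qed
  have zero: "0 \<notin> set ?h \<longleftrightarrow> 0 \<notin> set g"
    using set_block N by auto
  define Q where "Q h j \<longleftrightarrow> (h ! (j - 1) = h ! j \<longrightarrow>
        (j \<notin> I \<longrightarrow> h ! j > 0) \<and> (j \<in> I \<longrightarrow> h ! j < 0))" for h :: "int list" and j
  have low: "Q ?h j \<longleftrightarrow> Q g j" if "j \<in> {1..<s}" for j
    using that len by (auto simp: Q_def nth_append)
  have mid: "Q ?h s" if "s \<in> {1..<s + a}"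
  proof -
    have "nat \<bar>?h ! (s - 1)\<bar> < N" using that len g by (auto simp: nth_append)
    moreover have "nat \<bar>?h ! s\<bar> = N" using that len b by (auto simp: nth_append nth_block)
    ultimately show ?thesis by (auto simp: Q_def)
  qed
  have high: "Q ?h (s + i) \<longleftrightarrow> (i < b \<longrightarrow> s + i \<in> I) \<and> (b < i \<longrightarrow> s + i \<notin> I)" if "i \<in> {1..<a}" for i
  proof -
    have "?h ! (s + i) = block N a b ! i" "?h ! (s + i - 1) = block N a b ! (i - 1)"
      using len that by (auto simp: nth_append)
    then show ?thesis using that b N by (auto simp: Q_def nth_block)
  qed
  have cases: "j \<in> {1..<s} \<or> j = s \<or> (\<exists>i\<in>{1..<a}. j = s + i)" if "j \<in> {1..<s + a}" for j
    using that by (cases "s < j") (auto intro!: bexI[of _ "j - s"])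
  have "(\<forall>j\<in>{1..<s + a}. Q ?h j) \<longleftrightarrow> (\<forall>j\<in>{1..<s}. Q g j) \<and> (\<forall>i\<in>{1..<a}. Q ?h (s + i))"
  proof (intro iffI conjI ballI; (elim conjE)?)
    fix j assume "\<forall>j\<in>{1..<s}. Q g j" "\<forall>i\<in>{1..<a}. Q ?h (s + i)" "j \<in> {1..<s + a}"
    then show "Q ?h j" using cases[of j] low mid by blast
  qed (use low in auto)
  also have "\<dots> \<longleftrightarrow> (\<forall>j\<in>{1..<s}. Q g j) \<and>
      (\<forall>i\<in>{1..<a}. (i < b \<longrightarrow> s + i \<in> I) \<and> (b < i \<longrightarrow> s + i \<notin> I))"
    using high by simp
  also have "(\<forall>i\<in>{1..<a}. (i < b \<longrightarrow> s + i \<in> I) \<and> (b < i \<longrightarrow> s + i \<notin> I)) \<longleftrightarrow> fits I s a b"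
    using b by (auto simp: fits_def)
  finally show ?thesis
    using sorted zero len b by (auto simp: enriched_def length_block Q_def)
qed

lemma card_negative: "card {j\<in>{1..length g}. g ! (j - 1) < 0} = length (filter (\<lambda>x. x < 0) g)"
  for g :: "int list"
proof -
  have "{j\<in>{1..length g}. g ! (j - 1) < 0} = Suc ` {i. i < length g \<and> g ! i < 0}"
    by (force simp: image_iff Bex_def intro: exI[of _ "_ - 1"])
  then show ?thesis
    by (simp add: card_image length_filter_conv_card)
qed

lemma coeff_qfund:
  "coeff (qfund q n I) M =
    (\<Sum>g | g \<in> enriched n I \<and> monom_of_seq g = M. q ^ length (filter (\<lambda>x. x < 0) g))"
  unfolding qfund.rep_eq
  by (rule sum.cong) (auto simp: enriched_def simp flip: card_negative)

lemma coeff_qfund_size: "size M \<noteq> n \<Longrightarrow> coeff (qfund q n I) M = 0"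
  unfolding coeff_qfund by (rule sum.neutral) (auto simp: enriched_def monom_of_seq_def)

lemma qfund_cong: "I \<inter> {1..<n} = J \<inter> {1..<n} \<Longrightarrow> qfund q n I = qfund q n J"
proof -
  assume IJ: "I \<inter> {1..<n} = J \<inter> {1..<n}"
  have "j \<in> I \<longleftrightarrow> j \<in> J" if "j \<in> {1..<n}" for j using IJ that by blast
  then have "enriched n I = enriched n J" by (simp add: enriched_def)
  then show ?thesis by (intro coeff_eqI) (simp add: qfund.rep_eq)
qed

lemma block_weight_cong:
  "I \<inter> {s<..<s + a} = J \<inter> {s<..<s + a} \<Longrightarrow> block_weight q I s a = block_weight q J s a"
proof -
  assume eq: "I \<inter> {s<..<s + a} = J \<inter> {s<..<s + a}"
  have IJ: "s + i \<in> I \<longleftrightarrow> s + i \<in> J" if "0 < i \<and> i < a" for i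
  proof -
    have "s + i \<in> I \<inter> {s<..<s + a} \<longleftrightarrow> s + i \<in> J \<inter> {s<..<s + a}" by (simp only: eq)
    then show ?thesis using that by simp
  qed
  have "fits I s a b \<longleftrightarrow> fits J s a b" if "b \<le> a" for b
    unfolding fits_def using that by (intro conj_cong ball_cong refl) (simp_all add: IJ)
  then show ?thesis unfolding block_weight_def
    by (intro sum.cong Collect_cong conj_cong refl)
qed

lemma block_weight_eq_sum: "block_weight q I s a = (\<Sum>b\<le>a. q ^ b * of_bool (fits I s a b))"
proof -
  have "block_weight q I s a = (\<Sum>b | b \<in> {..a} \<and> fits I s a b. q ^ b)"
    unfolding block_weight_def by (rule sum.cong) auto
  also have "\<dots> = (\<Sum>b\<le>a. if fits I s a b then q ^ b else 0)"
    by (rule sum.inter_filter) simp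
  finally show ?thesis by (simp add: of_bool_def if_distrib cong: if_cong)
qed

text \<open>
  In a sequence with monomial \<open>M x\<^sub>N\<^sup>a\<close>, where \<open>N\<close> exceeds all indices in \<open>M\<close>, the entries \<open>\<plusminus>N\<close> are
  the last \<open>a\<close> ones. So the sequence is a shorter one followed by a block, and the two parts are
  independent of each other: the index \<open>n - a\<close>, where they meet, compares entries of different
  absolute value.
\<close>

lemma coeff_qfund_block:
  assumes N: "N > 0" and M: "\<forall>x\<in>#M. x < N" and a: "a \<le> n"
  shows "coeff (qfund q n I) (M + replicate_mset a N) =
    block_weight q I (n - a) a * coeff (qfund q (n - a) I) M"
proof -
  define s where "s = n - a"
  have n: "n = s + a" using a by (simp add: s_def)
  define B where "B = {b. b \<le> a \<and> fits I s a b}"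
  define G where "G = {g. g \<in> enriched s I \<and> monom_of_seq g = M}"
  have G_small: "\<forall>x\<in>set g. nat \<bar>x\<bar> < N" if "monom_of_seq g = M" for g
    using that M by (auto simp: monom_of_seq_def)
  have monom_block: "monom_of_seq (g @ block N a b) = monom_of_seq g + replicate_mset a N"
    if "b \<le> a" for g b
  proof -
    have "replicate_mset b N + replicate_mset (a - b) N = replicate_mset a N"
      using that by (intro multiset_eqI) simp
    then show ?thesis by (simp add: monom_of_seq_def block_def)
  qed
  \<comment> \<open>The sequences of the given monomial are those of \<open>M\<close> with a block appended.\<close>
  have image: "{g. g \<in> enriched n I \<and> monom_of_seq g = M + replicate_mset a N} =
      (\<lambda>(b, g). g @ block N a b) ` (B \<times> G)" (is "?L = ?R")
  proof
    show "?R \<subseteq> ?L"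
    proof safe
      fix b g assume "b \<in> B" "g \<in> G"
      moreover from \<open>g \<in> G\<close> have "length g = s" "monom_of_seq g = M"
        by (auto simp: G_def enriched_def)
      ultimately show "g @ block N a b \<in> enriched n I"
        "monom_of_seq (g @ block N a b) = M + replicate_mset a N"
        using enriched_append_block[OF N _ G_small] monom_block n by (auto simp: B_def G_def)
    qed
    show "?L \<subseteq> ?R"
    proof safe
      fix g assume g: "g \<in> enriched n I" and m: "monom_of_seq g = M + replicate_mset a N"
      let ?f = "map (\<lambda>x. nat \<bar>x\<bar>)"
      define u where "u = take s g"
      define h where "h = drop s g"
      have len: "length g = s + a" and srt: "sorted_wrt pm_le g"
        using g n by (auto simp: enriched_def)
      have "sorted (?f g)"
        unfolding sorted_map
        by (rule sorted_wrt_mono_rel[OF _ srt]) (auto dest: pm_le_abs)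
      moreover have "sorted (sorted_list_of_multiset M @ replicate a N)"
        using M by (auto simp: sorted_append intro: less_imp_le)
      moreover have "mset (?f g) = mset (sorted_list_of_multiset M @ replicate a N)"
        using m by (simp add: monom_of_seq_def)
      ultimately have f: "?f g = sorted_list_of_multiset M @ replicate a N"
        by (metis properties_for_sort sorted_sort_id)
      have "size M = s"
        using arg_cong[OF m, of size] len by (simp add: monom_of_seq_def)
      then have lenM: "length (sorted_list_of_multiset M) = s"
        by (metis mset_sorted_list_of_multiset size_mset)
      have "?f u = sorted_list_of_multiset M" "?f h = replicate a N"
        using f lenM unfolding u_def h_def by (simp_all add: take_map[symmetric] drop_map[symmetric] del: map_append)
      then have "monom_of_seq u = M" and "set (?f h) \<subseteq> {N}"
        unfolding monom_of_seq_def by (simp_all only: mset_sorted_list_of_multiset set_replicate_conv_if) auto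
      then have u: "monom_of_seq u = M" and hN: "\<forall>x\<in>set h. nat \<bar>x\<bar> = N" by auto
      obtain b where b: "b \<le> a" "h = block N a b"
        using sorted_block[OF _ hN] srt len by (auto simp: h_def sorted_wrt_drop)
      have split: "g = u @ block N a b"
        using b by (metis append_take_drop_id h_def u_def)
      have "length u = s" using len by (simp add: u_def)
      then have "u \<in> G" "b \<in> B"
        using g enriched_append_block[OF N b(1) G_small[OF u], of s I] b(1) split u n
        by (simp_all add: B_def G_def)
      then show "g \<in> ?R" using split by (intro image_eqI[of _ _ "(b, u)"]) auto
    qed
  qed
  have inj: "inj_on (\<lambda>(b, g). g @ block N a b) (B \<times> G)"
  proof (rule inj_onI, clarify)
    fix b g c h assume b: "b \<in> B" "c \<in> B" and "g \<in> G" "h \<in> G"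
      and eq: "g @ block N a b = h @ block N a c"
    then have "length g = length h" by (auto simp: G_def enriched_def)
    then have gh: "g = h" "block N a b = block N a c" using eq by auto
    have "length (filter (\<lambda>x. x < 0) (block N a d)) = d" if "d \<le> a" for d
      using N by (simp add: block_def)
    moreover have "b \<le> a" "c \<le> a" using b by (auto simp: B_def)
    ultimately show "b = c \<and> g = h" using gh by metis
  qed
  have "coeff (qfund q n I) (M + replicate_mset a N) =
      (\<Sum>(b, g)\<in>B \<times> G. q ^ length (filter (\<lambda>x. x < 0) (g @ block N a b)))"
    unfolding coeff_qfund image sum.reindex[OF inj] by (simp add: split_def)
  also have "\<dots> = (\<Sum>(b, g)\<in>B \<times> G. q ^ b * q ^ length (filter (\<lambda>x. x < 0) g))"
    using N by (intro sum.cong) (auto simp: block_def power_add mult.commute)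
  also have "\<dots> = (\<Sum>b\<in>B. q ^ b) * (\<Sum>g\<in>G. q ^ length (filter (\<lambda>x. x < 0) g))"
    by (simp add: sum_product sum.cartesian_product)
  finally show ?thesis
    by (simp add: block_weight_def coeff_qfund B_def G_def s_def)
qed

lemma nonempty_monomial_cases:
  fixes M :: "nat multiset"
  assumes "M \<noteq> {#}" "0 \<notin># M"
  obtains M' N a where "M = M' + replicate_mset a N" "a > 0" "N > 0" "\<forall>x\<in>#M'. x < N"
proof -
  define N where "N = Max (set_mset M)"
  have N: "N \<in># M" "\<forall>x\<in>#M. x \<le> N" using assms by (auto simp: N_def)
  show thesis
  proof
    show "M = filter_mset (\<lambda>x. x \<noteq> N) M + replicate_mset (count M N) N"
      by (rule multiset_eqI) auto
    show "N > 0" using N assms(2) by (auto intro: gr0I)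
    show "count M N > 0" using N by simp
    show "\<forall>x\<in>#filter_mset (\<lambda>x. x \<noteq> N) M. x < N" using N by auto
  qed
qed

text \<open>
  Induction on monomials by splitting off the power of the last variable, as in
  \<open>coeff_qfund_block\<close>. A monomial that contains the index \<open>0\<close> occurs in no power series, hence the
  separate case.
\<close>

lemma monomial_induct [case_names zero_index empty block]:
  fixes M :: "nat multiset"
  assumes "\<And>M. 0 \<in># M \<Longrightarrow> P M" and "P {#}"
    and "\<And>M N a. P M \<Longrightarrow> a > 0 \<Longrightarrow> N > 0 \<Longrightarrow> \<forall>x\<in>#M. x < N \<Longrightarrow> P (M + replicate_mset a N)"
  shows "P M"
proof (induction "size M" arbitrary: M rule: less_induct)
  case less
  show ?case
  proof (cases "M = {#} \<or> 0 \<in># M")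
    case True then show ?thesis using assms by auto
  next
    case False
    then obtain M' N a where "M = M' + replicate_mset a N" "a > 0" "N > 0" "\<forall>x\<in>#M'. x < N"
      using nonempty_monomial_cases[of M] by metis
    then show ?thesis using less assms(3) by simp
  qed
qed

lemma coeff_qfund_block_if:
  assumes "N > 0" "\<forall>x\<in>#M. x < N"
  shows "coeff (qfund q n I) (M + replicate_mset a N) =
    (if a \<le> n then block_weight q I (n - a) a * coeff (qfund q (n - a) I) M else 0)"
  using assms coeff_qfund_block coeff_qfund_size by auto

lemma coeff_qfund_empty: "coeff (qfund q n I) {#} = (if n = 0 then 1 else 0)"
proof (cases "n = 0")
  case True
  then have "qfund q n I = 1" using qfund_cong[of I 0 "{}"] by (simp add: qfund_0)
  then show ?thesis using True by (simp add: one_power_series.rep_eq)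
qed (simp add: coeff_qfund_size)

lemma coeff_scale: "coeff (scale c f) M = c * coeff f M"
  by transfer simp

lemma coeff_sum: "coeff (\<Sum>x\<in>A. f x) M = (\<Sum>x\<in>A. coeff (f x) M)"
  by (induction A rule: infinite_finite_induct)
    (simp_all add: zero_power_series.rep_eq plus_power_series.rep_eq)

section \<open>Quasisymmetry\<close>

lemma monom_of_snoc:
  "length is = length as \<Longrightarrow> monom_of (is @ [i]) (as @ [a]) = monom_of is as + replicate_mset a i"
  by (simp add: monom_of_def)

lemma set_monom_of: "length is = length as \<Longrightarrow> set_mset (monom_of is as) \<subseteq> set is"
proof (induction "is" as rule: list_induct2)
  case (Cons i "is" a as)
  then show ?case by (auto simp: monom_of_def split: if_splits)
qed (simp add: monom_of_def)

text \<open>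
  The factors that are split off with the last variables depend on the exponents only.
\<close>

lemma coeff_qfund_monom_of:
  assumes "length is = length as" "length js = length as" "sorted_wrt (<) is" "sorted_wrt (<) js"
    "0 \<notin> set is" "0 \<notin> set js"
  shows "coeff (qfund q n I) (monom_of is as) = coeff (qfund q n I) (monom_of js as)"
  using assms
proof (induction as arbitrary: "is" js n rule: rev_induct)
  case Nil
  then show ?case by simp
next
  case (snoc a as)
  obtain i is' j js' where eqs: "is = is' @ [i]" "js = js' @ [j]"
    using snoc.prems(1,2) by (metis append_is_Nil_conv length_0_conv not_Cons_self2 rev_exhaust)
  have step: "coeff (qfund q n I) (monom_of (ks @ [k]) (as @ [a])) =
      (if a \<le> n then block_weight q I (n - a) a * coeff (qfund q (n - a) I) (monom_of ks as) else 0)"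
    if "length ks = length as" "sorted_wrt (<) (ks @ [k])" "0 \<notin> set (ks @ [k])" for ks k
  proof -
    have "\<forall>x\<in>#monom_of ks as. x < k"
      using set_monom_of[OF that(1)] that(2) by (auto simp: sorted_wrt_append)
    moreover have "k > 0" using that(3) by simp
    ultimately show ?thesis using that(1) by (simp add: monom_of_snoc coeff_qfund_block_if)
  qed
  have "coeff (qfund q (n - a) I) (monom_of is' as) = coeff (qfund q (n - a) I) (monom_of js' as)"
    using snoc.prems by (intro snoc.IH) (auto simp: eqs sorted_wrt_append)
  then show ?case using step snoc.prems by (simp add: eqs)
qed

lemma qfund_in_QSym: "qfund q n I \<in> QSym"
  unfolding QSym_def
proof (intro CollectI conjI)
  show "\<exists>d. \<forall>M. coeff (qfund q n I) M \<noteq> 0 \<longrightarrow> size M \<le> d"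
    using coeff_qfund_size by (metis order_refl)
qed (use coeff_qfund_monom_of in blast)

text \<open>
  Quasisymmetry is a degree bound together with linear equations between coefficients.
\<close>

lemma subspace_QSym: "PS.subspace QSym"
proof -
  define bounded where "bounded f \<longleftrightarrow> (\<exists>d. \<forall>M. coeff f M \<noteq> 0 \<longrightarrow> size M \<le> d)" for f
  define R where "R M M' \<longleftrightarrow> (\<exists>is js as. M = monom_of is as \<and> M' = monom_of js as \<and>
    length is = length as \<and> length js = length as \<and> sorted_wrt (<) is \<and> sorted_wrt (<) js \<and>
    0 \<notin> set is \<and> 0 \<notin> set js \<and> 0 \<notin> set as)" for M M'
  have QSym: "QSym = {f. bounded f \<and> (\<forall>M M'. R M M' \<longrightarrow> coeff f M = coeff f M')}"
    unfolding QSym_def bounded_def R_def by blast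
  have "bounded (f + g)" if fg: "bounded f" "bounded g" for f g
  proof -
    obtain d e where de: "\<forall>M. coeff f M \<noteq> 0 \<longrightarrow> size M \<le> d" "\<forall>M. coeff g M \<noteq> 0 \<longrightarrow> size M \<le> e"
      using fg by (auto simp: bounded_def)
    have "size M \<le> max d e" if "coeff (f + g) M \<noteq> 0" for M
    proof -
      have "coeff f M \<noteq> 0 \<or> coeff g M \<noteq> 0" using that by (auto simp: plus_power_series.rep_eq)
      then show ?thesis using de by (auto simp: le_max_iff_disj)
    qed
    then show ?thesis unfolding bounded_def by blast
  qed
  moreover have "bounded 0" "bounded (scale c f)" if "bounded f" for c f
    using that by (auto simp: bounded_def zero_power_series.rep_eq coeff_scale)
  ultimately show ?thesis
    unfolding PS.subspace_def QSym
    by (auto simp: plus_power_series.rep_eq zero_power_series.rep_eq coeff_scale bounded_def)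
qed

section \<open>Words, descents and shuffle products\<close>

definition descents :: "int list \<Rightarrow> nat set" where
  "descents t = {j. 1 \<le> j \<and> j < length t \<and> t ! (j - 1) > t ! j}"

definition word_qfund :: "complex \<Rightarrow> int list \<Rightarrow> power_series" where
  "word_qfund q t = qfund q (length t) (descents t)"

text \<open>
  Append letters one by one, each larger or smaller than all the previous ones, as prescribed. Since
  there are always infinitely many choices, a finite set of letters can be avoided.
\<close>

lemma exists_word_with_descents:
  assumes "finite F" "I \<subseteq> {1..<n}"
  shows "\<exists>t. length t = n \<and> set t \<inter> F = {} \<and> descents t = I"
  using assms(2)
proof (induction n arbitrary: I)
  case 0
  then show ?case by (auto simp: descents_def)
next
  case (Suc n)
  have "I \<inter> {1..<n} \<subseteq> {1..<n}" by simp
  then obtain t where t: "length t = n" "set t \<inter> F = {}" "descents t = I \<inter> {1..<n}"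
    using Suc.IH by blast
  obtain x where x: "x \<notin> F" "\<forall>y\<in>set t. if n \<in> I then x < y else y \<le> x"
  proof (cases "n \<in> I")
    case True
    have "Min (insert 0 (F \<union> set t)) - 1 < y" if "y \<in> F \<union> set t" for y
    proof -
      have "Min (insert 0 (F \<union> set t)) \<le> y" using that assms(1) by (intro Min_le) auto
      then show ?thesis by simp
    qed
    then show ?thesis using True that[of "Min (insert 0 (F \<union> set t)) - 1"] by fastforce
  next
    case False
    have "y < Max (insert 0 (F \<union> set t)) + 1" if "y \<in> F \<union> set t" for y
    proof -
      have "y \<le> Max (insert 0 (F \<union> set t))" using that assms(1) by (intro Max_ge) auto
      then show ?thesis by simp
    qed
    then show ?thesis using False that[of "Max (insert 0 (F \<union> set t)) + 1"] by fastforce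
  qed
  have "j \<in> descents (t @ [x]) \<longleftrightarrow> j \<in> I" for j
  proof -
    consider "j < n" | "j = n" "n = 0" | "j = n" "n > 0" | "j > n" by linarith
    then show ?thesis
    proof cases
      case 1
      then have "j \<in> descents (t @ [x]) \<longleftrightarrow> j \<in> descents t"
        using t(1) by (auto simp: descents_def nth_append)
      then show ?thesis using 1 Suc.prems t(3) by auto
    next
      case 2
      then show ?thesis using Suc.prems by (auto simp: descents_def)
    next
      case 3
      then have "t ! (n - 1) \<in> set t" using t(1) by simp
      then have "x < t ! (n - 1) \<longleftrightarrow> n \<in> I" using x(2) by (cases "n \<in> I") force+
      then show ?thesis using 3 t(1) by (simp add: descents_def nth_append)
    next
      case 4
      then show ?thesis using Suc.prems t(1) by (auto simp: descents_def)
    qed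
  qed
  then have "descents (t @ [x]) = I" by blast
  then show ?case using t x by (intro exI[of _ "t @ [x]"]) auto
qed

text \<open>
  In terms of words, a block becomes a factorisation of the word into a decreasing part, which
  carries the negative entries, and a weakly increasing part.
\<close>

definition valley_weight :: "complex \<Rightarrow> int list \<Rightarrow> complex" where
  "valley_weight q v =
    (\<Sum>b\<le>length v. q ^ b * of_bool (sorted_wrt (>) (take b v)) * of_bool (sorted (drop b v)))"

lemma sorted_wrt_iff_neighbours:
  assumes "transp R"
  shows "sorted_wrt R v \<longleftrightarrow> (\<forall>i\<in>{1..<length v}. R (v ! (i - 1)) (v ! i))"
  unfolding sorted_wrt_iff_nth_Suc_transp[OF assms]
proof (intro iffI ballI allI impI)
  fix i assume "\<forall>i. Suc i < length v \<longrightarrow> R (v ! i) (v ! Suc i)" "i \<in> {1..<length v}"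
  then show "R (v ! (i - 1)) (v ! i)" by (cases i) auto
qed force

lemma block_weight_descents:
  assumes "a \<le> length t"
  shows "block_weight q (descents t) (length t - a) a = valley_weight q (drop (length t - a) t)"
proof -
  define s where "s = length t - a"
  define v where "v = drop s t"
  have len: "length t = s + a" "length v = a" using assms by (auto simp: s_def v_def)
  have desc: "s + i \<in> descents t \<longleftrightarrow> v ! (i - 1) > v ! i" if "1 \<le> i" "i < a" for i
    using that len by (auto simp: descents_def v_def)
  have "fits (descents t) s a b \<longleftrightarrow> sorted_wrt (>) (take b v) \<and> sorted (drop b v)" if "b \<le> a" for b
  proof -
    have "(\<forall>i\<in>{1..<b}. s + i \<in> descents t) \<longleftrightarrow> sorted_wrt (>) (take b v)"
    proof -
      have "take b v ! (i - 1) = v ! (i - 1)" if "i \<in> {1..<b}" for i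
        using that by (intro nth_take) auto
      moreover have "length (take b v) = b" using that len by simp
      ultimately show ?thesis
        using that desc by (subst sorted_wrt_iff_neighbours) (auto intro!: transpI)
    qed
    moreover have "(\<forall>i\<in>{b<..<a}. s + i \<notin> descents t) \<longleftrightarrow> (\<forall>i\<in>{b<..<a}. v ! (i - 1) \<le> v ! i)"
      using desc by (intro ball_cong refl) (auto simp: not_less)
    moreover have "\<dots> \<longleftrightarrow> (\<forall>i\<in>{1..<a - b}. v ! (b + i - 1) \<le> v ! (b + i))"
    proof -
      have "{b<..<a} = (\<lambda>i. b + i) ` {1..<a - b}"
        using that by (simp add: add.commute flip: atLeastSucLessThan_greaterThanLessThan)
      then show ?thesis by (simp only: ball_simps)
    qed
    moreover have "\<dots> \<longleftrightarrow> sorted (drop b v)"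
    proof -
      have "drop b v ! (i - 1) = v ! (b + i - 1)" "drop b v ! i = v ! (b + i)" if "i \<in> {1..<a - b}" for i
        using that \<open>b \<le> a\<close> len by simp_all
      then show ?thesis using len by (subst sorted_wrt_iff_neighbours) (auto intro!: transpI)
    qed
    ultimately show ?thesis unfolding fits_def by blast
  qed
  then show ?thesis
    unfolding s_def[symmetric] v_def[symmetric] block_weight_eq_sum valley_weight_def len(2)
    by (intro sum.cong) auto
qed

lemma coeff_word_qfund_block:
  assumes "N > 0" "\<forall>x\<in>#M. x < N"
  shows "coeff (word_qfund q t) (M + replicate_mset a N) =
    (if a \<le> length t then valley_weight q (drop (length t - a) t) *
       coeff (word_qfund q (take (length t - a) t)) M else 0)"
proof -
  let ?s = "length t - a"
  have "qfund q ?s (descents t) = word_qfund q (take ?s t)"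
    unfolding word_qfund_def by (subst length_take) (auto intro!: qfund_cong simp: descents_def)
  then show ?thesis
    using assms by (simp add: word_qfund_def coeff_qfund_block_if block_weight_descents)
qed

lemma append_in_shuffles:
  "x \<in> shuffles a b \<Longrightarrow> y \<in> shuffles c d \<Longrightarrow> x @ y \<in> shuffles (a @ c) (b @ d)"
proof (induction a b arbitrary: x rule: shuffles.induct)
  case (1 b)
  then show ?case
    by (induction b arbitrary: x) (auto intro: Cons_in_shuffles_rightI)
next
  case (2 z a)
  have "w @ y \<in> shuffles (w @ c) d" for w
    using 2(2) by (induction w) (auto intro: Cons_in_shuffles_leftI)
  then show ?case using 2(1) by simp
next
  case (3 z a w b)
  then show ?case by (auto intro: Cons_in_shuffles_leftI Cons_in_shuffles_rightI)
qed

text \<open>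
  Deconcatenation is compatible with shuffling: cutting a shuffle of \<open>u\<close> and \<open>v\<close> in two amounts to
  cutting \<open>u\<close> and \<open>v\<close> in two and shuffling the left parts and the right parts separately. The
  letters of \<open>u\<close> and \<open>v\<close> are different, so the cuts of \<open>u\<close> and \<open>v\<close> can be recovered.
\<close>

lemma sum_shuffles_take_drop:
  fixes F :: "'a list \<Rightarrow> 'a list \<Rightarrow> 'b :: comm_monoid_add"
  assumes disj: "set u \<inter> set v = {}" and k: "k \<le> length u + length v"
  shows "(\<Sum>t\<in>shuffles u v. F (take k t) (drop k t)) =
    (\<Sum>(i, j) | i \<le> length u \<and> j \<le> length v \<and> i + j = k.
      \<Sum>x\<in>shuffles (take i u) (take j v). \<Sum>y\<in>shuffles (drop i u) (drop j v). F x y)"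
proof -
  let ?P = "\<lambda>x. x \<in> set u"
  define D where "D = {(i, j). i \<le> length u \<and> j \<le> length v \<and> i + j = k}"
  define S where "S = (\<lambda>(i, j). shuffles (take i u) (take j v) \<times> shuffles (drop i u) (drop j v))"
  have fin: "finite D" by (rule finite_subset[of _ "{..length u} \<times> {..length v}"]) (auto simp: D_def)
  have fin': "finite (S d)" for d by (simp add: S_def split_def)
  have filter_part: "filter ?P x = a" if "x \<in> shuffles a b" "set a \<subseteq> set u" "set b \<subseteq> set v" for x a b
  proof -
    have "filter ?P a = a" "filter ?P b = []"
      using that disj by (auto simp: filter_id_conv filter_empty_conv)
    then show ?thesis using that(1) filter_shuffles[of ?P a b] by auto
  qed
  have "(\<Sum>t\<in>shuffles u v. F (take k t) (drop k t)) = (\<Sum>(d, x, y)\<in>Sigma D S. F x y)"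
  proof (rule sum.reindex_bij_witness[of _ "\<lambda>(d, x, y). x @ y"
      "\<lambda>t. ((length (filter ?P (take k t)), length (filter (\<lambda>x. \<not> ?P x) (take k t))), take k t, drop k t)"])
    fix t assume t: "t \<in> shuffles u v"
    let ?x = "take k t" and ?y = "drop k t"
    have f: "filter ?P t = u" "filter (\<lambda>x. \<not> ?P x) t = v"
      using t disj by (auto simp: filter_shuffles_disjoint1)
    have u: "u = filter ?P ?x @ filter ?P ?y"
      unfolding filter_append[symmetric] append_take_drop_id f ..
    have v: "v = filter (\<lambda>x. \<not> ?P x) ?x @ filter (\<lambda>x. \<not> ?P x) ?y"
      unfolding filter_append[symmetric] append_take_drop_id f ..
    define i where "i = length (filter ?P ?x)"
    define j where "j = length (filter (\<lambda>x. \<not> ?P x) ?x)"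
    have parts: "filter ?P ?x = take i u" "filter ?P ?y = drop i u"
      "filter (\<lambda>x. \<not> ?P x) ?x = take j v" "filter (\<lambda>x. \<not> ?P x) ?y = drop j v"
      by (metis u v i_def j_def append_eq_conv_conj)+
    have "i + j = k"
      using k length_shuffles[OF t] sum_length_filter_compl[of ?P ?x] by (simp add: i_def j_def)
    moreover have "i \<le> length u" "j \<le> length v"
      using u v unfolding i_def j_def by (metis le_add1 length_append)+
    moreover have "?x \<in> shuffles (take i u) (take j v)" "?y \<in> shuffles (drop i u) (drop j v)"
      unfolding parts[symmetric] by (rule partition_in_shuffles)+
    ultimately show "((length (filter ?P ?x), length (filter (\<lambda>x. \<not> ?P x) ?x)), ?x, ?y) \<in> Sigma D S"
      unfolding i_def[symmetric] j_def[symmetric] by (simp add: D_def S_def)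
  next
    fix e assume "e \<in> Sigma D S"
    then obtain i j x y where e: "e = ((i, j), x, y)" "i \<le> length u" "j \<le> length v" "i + j = k"
      "x \<in> shuffles (take i u) (take j v)" "y \<in> shuffles (drop i u) (drop j v)"
      by (auto simp: D_def S_def)
    show "(case e of (d, x, y) \<Rightarrow> x @ y) \<in> shuffles u v"
      using append_in_shuffles[OF e(5,6)] by (simp add: e(1))
    have len: "length x = k" using length_shuffles[OF e(5)] e by simp
    have "filter ?P x = take i u"
      using e(5) by (rule filter_part) (auto dest: in_set_takeD)
    then have "length (filter ?P x) = i" using e(2) by simp
    moreover from this have "length (filter (\<lambda>x. \<not> ?P x) x) = j"
      using sum_length_filter_compl[of ?P x] len e(4) by simp
    ultimately show "((length (filter ?P (take k (case e of (d, x, y) \<Rightarrow> x @ y))),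
        length (filter (\<lambda>x. \<not> ?P x) (take k (case e of (d, x, y) \<Rightarrow> x @ y)))),
        take k (case e of (d, x, y) \<Rightarrow> x @ y), drop k (case e of (d, x, y) \<Rightarrow> x @ y)) = e"
      using len by (simp add: e(1))
  qed simp_all
  also have "\<dots> = (\<Sum>d\<in>D. \<Sum>(x, y)\<in>S d. F x y)"
    by (rule sum.Sigma[symmetric]) (use fin fin' in auto)
  also have "\<dots> = (\<Sum>(i, j)\<in>D. \<Sum>x\<in>shuffles (take i u) (take j v). \<Sum>y\<in>shuffles (drop i u) (drop j v). F x y)"
    by (intro sum.cong refl) (auto simp: S_def sum.cartesian_product)
  finally show ?thesis by (simp add: D_def)
qed

text \<open>
  Merging two sorted words in order is possible in exactly one way if no letter of \<open>u\<close> is tied with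
  one of \<open>v\<close>, and a shuffle of words that are not both sorted is never sorted. In other words, the
  indicator of sortedness is a character for the shuffle product.
\<close>

lemma sum_shuffles_sorted:
  assumes "transp R" and "\<And>x y. x \<in> set u \<Longrightarrow> y \<in> set v \<Longrightarrow> R x y \<noteq> R y x"
  shows "(\<Sum>t\<in>shuffles u v. of_bool (sorted_wrt R t)) =
    (of_bool (sorted_wrt R u) * of_bool (sorted_wrt R v) :: complex)"
  using assms(2)
proof (induction u v rule: shuffles.induct)
  case (3 x u y v)
  have cons: "(\<Sum>t\<in>(#) z ` shuffles a b. of_bool (sorted_wrt R t)) =
      of_bool (\<forall>w\<in>set a \<union> set b. R z w) * (\<Sum>t\<in>shuffles a b. of_bool (sorted_wrt R t) :: complex)"
    for z a b
  proof -
    have "(\<Sum>t\<in>(#) z ` shuffles a b. of_bool (sorted_wrt R t) :: complex) =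
        (\<Sum>t\<in>shuffles a b. of_bool (sorted_wrt R (z # t)))"
      by (subst sum.reindex) auto
    also have "\<dots> = (\<Sum>t\<in>shuffles a b. of_bool (\<forall>w\<in>set a \<union> set b. R z w) * of_bool (sorted_wrt R t))"
      by (intro sum.cong refl) (auto simp: set_shuffles)
    finally show ?thesis by (simp add: sum_distrib_left)
  qed
  have xy: "R x y \<noteq> R y x" using "3.prems" by simp
  have "(#) x ` shuffles u (y # v) \<inter> (#) y ` shuffles (x # u) v = {}"
    using xy by auto
  moreover have "(\<Sum>t\<in>shuffles u (y # v). of_bool (sorted_wrt R t) :: complex) =
      of_bool (sorted_wrt R u) * of_bool (sorted_wrt R (y # v))"
    by (rule "3.IH"(1)) (use "3.prems" in auto)
  moreover have "(\<Sum>t\<in>shuffles (x # u) v. of_bool (sorted_wrt R t) :: complex) =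
      of_bool (sorted_wrt R (x # u)) * of_bool (sorted_wrt R v)"
    by (rule "3.IH"(2)) (use "3.prems" in auto)
  ultimately have "(\<Sum>t\<in>shuffles (x # u) (y # v). of_bool (sorted_wrt R t) :: complex) =
      of_bool (\<forall>w\<in>set u \<union> set (y # v). R x w) * (of_bool (sorted_wrt R u) * of_bool (sorted_wrt R (y # v))) +
      of_bool (\<forall>w\<in>set (x # u) \<union> set v. R y w) * (of_bool (sorted_wrt R (x # u)) * of_bool (sorted_wrt R v))"
    by (simp only: shuffles.simps sum.union_disjoint finite_imageI finite_shuffles cons)
  also have "\<dots> = of_bool (sorted_wrt R (x # u)) * of_bool (sorted_wrt R (y # v))"
  proof (cases "R x y")
    case True
    then have "(\<forall>w\<in>set u \<union> set (y # v). R x w) \<longleftrightarrow> (\<forall>w\<in>set u. R x w)" if "sorted_wrt R (y # v)"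
      using that assms(1) by (auto dest: transpD)
    then show ?thesis using xy True by auto
  next
    case False
    then have "(\<forall>w\<in>set (x # u) \<union> set v. R y w) \<longleftrightarrow> (\<forall>w\<in>set v. R y w)" if "sorted_wrt R (x # u)"
      using that assms(1) xy by (auto dest: transpD)
    then show ?thesis using xy False by auto
  qed
  finally show ?case .
qed simp_all

text \<open>
  The weight is the convolution, along deconcatenation, of the characters that indicate decreasing
  words (with the factor \<open>q\<close> for each letter) and weakly increasing words. A convolution of
  characters is a character.
\<close>

lemma sum_shuffles_valley_weight:
  assumes disj: "set u \<inter> set v = {}"
  shows "(\<Sum>t\<in>shuffles u v. valley_weight q t) = valley_weight q u * valley_weight q v"
proof -
  let ?m = "length u" and ?n = "length v"
  define f where "f t = (of_bool (sorted_wrt (>) t) :: complex)" for t :: "int list"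
  define g where "g t = (of_bool (sorted t) :: complex)" for t :: "int list"
  have weight: "valley_weight q t = (\<Sum>b\<le>length t. q ^ b * f (take b t) * g (drop b t))" for t
    by (simp add: valley_weight_def f_def g_def)
  have f: "(\<Sum>t\<in>shuffles a b. f t) = f a * f b" and g: "(\<Sum>t\<in>shuffles a b. g t) = g a * g b"
    if "set a \<subseteq> set u" "set b \<subseteq> set v" for a b
  proof -
    have "x \<noteq> y" if "x \<in> set a" "y \<in> set b" for x y
      using that \<open>set a \<subseteq> set u\<close> \<open>set b \<subseteq> set v\<close> disj by blast
    then have "(x > y) \<noteq> (y > x)" "(x \<le> y) \<noteq> (y \<le> x)" if "x \<in> set a" "y \<in> set b" for x y
      using that by (meson linorder_neqE not_less_iff_gr_or_eq order_antisym linorder_linear)+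
    then show "(\<Sum>t\<in>shuffles a b. f t) = f a * f b" "(\<Sum>t\<in>shuffles a b. g t) = g a * g b"
      unfolding f_def g_def by (intro sum_shuffles_sorted transpI; force)+
  qed
  define D where "D b = {(i, j). i \<le> ?m \<and> j \<le> ?n \<and> i + j = b}" for b
  have "(\<Sum>t\<in>shuffles u v. valley_weight q t) =
      (\<Sum>b\<le>?m + ?n. q ^ b * (\<Sum>t\<in>shuffles u v. f (take b t) * g (drop b t)))"
    unfolding weight sum_distrib_left
    by (subst sum.swap[symmetric]) (auto simp: length_shuffles mult.assoc intro!: sum.cong)
  also have "\<dots> = (\<Sum>b\<le>?m + ?n. \<Sum>(i, j)\<in>D b. q ^ (i + j) *
      (f (take i u) * f (take j v)) * (g (drop i u) * g (drop j v)))"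
  proof (intro sum.cong refl)
    fix b assume "b \<in> {..?m + ?n}"
    then have "(\<Sum>t\<in>shuffles u v. f (take b t) * g (drop b t)) =
        (\<Sum>(i, j)\<in>D b. \<Sum>x\<in>shuffles (take i u) (take j v). \<Sum>y\<in>shuffles (drop i u) (drop j v). f x * g y)"
      using sum_shuffles_take_drop[OF disj, of b "\<lambda>x y. f x * g y"] by (simp add: D_def)
    also have "\<dots> = (\<Sum>(i, j)\<in>D b. (f (take i u) * f (take j v)) * (g (drop i u) * g (drop j v)))"
      by (intro sum.cong refl)
        (auto simp: f g set_take_subset set_drop_subset simp flip: sum_distrib_left sum_distrib_right)
    finally show "q ^ b * (\<Sum>t\<in>shuffles u v. f (take b t) * g (drop b t)) =
        (\<Sum>(i, j)\<in>D b. q ^ (i + j) * (f (take i u) * f (take j v)) * (g (drop i u) * g (drop j v)))"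
      by (auto simp: D_def sum_distrib_left mult.assoc intro!: sum.cong)
  qed
  also have "\<dots> = (\<Sum>(i, j)\<in>{..?m} \<times> {..?n}. q ^ (i + j) *
      (f (take i u) * f (take j v)) * (g (drop i u) * g (drop j v)))"
  proof -
    have "D b = {d \<in> {..?m} \<times> {..?n}. fst d + snd d = b}" for b by (auto simp: D_def)
    then show ?thesis by (simp only:) (rule sum.group, auto)
  qed
  also have "\<dots> = valley_weight q u * valley_weight q v"
    unfolding weight sum_product sum.cartesian_product
    by (intro sum.cong refl) (auto simp: power_add)
  finally show ?thesis .
qed

lemma coeff_mult_block:
  assumes M: "\<forall>x\<in>#M. x < N"
  shows "coeff (f * g) (M + replicate_mset a N) = (\<Sum>b\<le>a. \<Sum>(A, B)\<in>splits M.
    coeff f (A + replicate_mset b N) * coeff g (B + replicate_mset (a - b) N))"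
proof -
  have N: "N \<notin># M" using M by auto
  have split: "C = filter_mset (\<lambda>x. x \<noteq> N) C + replicate_mset (count C N) N" for C
    by (rule multiset_eqI) auto
  have "coeff (f * g) (M + replicate_mset a N) = (\<Sum>(b, A, B)\<in>{..a} \<times> splits M.
      coeff f (A + replicate_mset b N) * coeff g (B + replicate_mset (a - b) N))"
    unfolding times_power_series.rep_eq
  proof (rule sum.reindex_bij_witness[of _
      "\<lambda>(b, A, B). (A + replicate_mset b N, B + replicate_mset (a - b) N)"
      "\<lambda>(C, D). (count C N, filter_mset (\<lambda>x. x \<noteq> N) C, filter_mset (\<lambda>x. x \<noteq> N) D)"])
    fix p assume "p \<in> splits (M + replicate_mset a N)"
    then obtain C D where p: "p = (C, D)" "C + D = M + replicate_mset a N"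
      by (auto simp: splits_def)
    have "count C N + count D N = a"
      using arg_cong[OF p(2), of "\<lambda>X. count X N"] N by (simp add: not_in_iff)
    then have D: "count D N = a - count C N" "count C N \<le> a" by auto
    have "filter_mset (\<lambda>x. x \<noteq> N) C + filter_mset (\<lambda>x. x \<noteq> N) D = filter_mset (\<lambda>x. x \<noteq> N) M"
      using arg_cong[OF p(2), of "filter_mset (\<lambda>x. x \<noteq> N)"] by simp
    also have "\<dots> = M" using N by (auto simp: filter_mset_eq_conv)
    finally show "(case p of (C, D) \<Rightarrow> (count C N, filter_mset (\<lambda>x. x \<noteq> N) C, filter_mset (\<lambda>x. x \<noteq> N) D))
        \<in> {..a} \<times> splits M" using D by (simp add: p splits_def)
    show "(case case p of (C, D) \<Rightarrow> (count C N, filter_mset (\<lambda>x. x \<noteq> N) C, filter_mset (\<lambda>x. x \<noteq> N) D) of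
        (b, A, B) \<Rightarrow> (A + replicate_mset b N, B + replicate_mset (a - b) N)) = p"
      using split[of C] split[of D] D by (simp add: p)
    then show "(case case p of (C, D) \<Rightarrow> (count C N, filter_mset (\<lambda>x. x \<noteq> N) C, filter_mset (\<lambda>x. x \<noteq> N) D) of
        (b, A, B) \<Rightarrow> coeff f (A + replicate_mset b N) * coeff g (B + replicate_mset (a - b) N)) =
        (case p of (A, B) \<Rightarrow> coeff f A * coeff g B)"
      by (auto simp: p)
  next
    fix e assume "e \<in> {..a} \<times> splits M"
    then obtain b A B where e: "e = (b, A, B)" "b \<le> a" "A + B = M" by (auto simp: splits_def)
    have "replicate_mset b N + replicate_mset (a - b) N = replicate_mset a N"
      using e(2) by (intro multiset_eqI) simp
    then show "(case e of (b, A, B) \<Rightarrow> (A + replicate_mset b N, B + replicate_mset (a - b) N))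
        \<in> splits (M + replicate_mset a N)"
      by (simp add: e(1) splits_def flip: e(3))
    have "N \<notin># A" "N \<notin># B" using N e(3) by auto
    moreover from this have "filter_mset (\<lambda>x. x \<noteq> N) A = A" "filter_mset (\<lambda>x. x \<noteq> N) B = B"
      by (auto simp: filter_mset_eq_conv)
    moreover have "filter_mset (\<lambda>x. x \<noteq> N) (replicate_mset c N) = {#}" for c
      by (intro multiset_eqI) auto
    ultimately show "(case case e of (b, A, B) \<Rightarrow> (A + replicate_mset b N, B + replicate_mset (a - b) N) of
        (C, D) \<Rightarrow> (count C N, filter_mset (\<lambda>x. x \<noteq> N) C, filter_mset (\<lambda>x. x \<noteq> N) D)) = e"
      by (simp add: e(1) not_in_iff)
  qed
  then show ?thesis by (simp add: sum.cartesian_product split_def)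
qed

text \<open>
  Multiplicativity passes through the induction on monomials: on the left, the power of the last
  variable is distributed over the two factors; on the right, the corresponding suffix of a shuffle
  is a shuffle of suffixes; and the weights of the suffixes agree by \<open>sum_shuffles_valley_weight\<close>.
\<close>

lemma word_qfund_mult:
  assumes "set u \<inter> set v = {}"
  shows "word_qfund q u * word_qfund q v = (\<Sum>t\<in>shuffles u v. word_qfund q t)"
proof (rule coeff_eqI)
  fix M
  show "coeff (word_qfund q u * word_qfund q v) M = coeff (\<Sum>t\<in>shuffles u v. word_qfund q t) M"
    using assms unfolding coeff_sum
  proof (induction M arbitrary: u v rule: monomial_induct)
    case (zero_index M)
    then show ?case by (simp add: coeff_zero_index)
  next
    case empty
    have "splits {#} = {({#}, {#})}" by (auto simp: splits_def)
    then have "coeff (word_qfund q u * word_qfund q v) {#} = of_bool (u = [] \<and> v = [])"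
      by (simp add: times_power_series.rep_eq word_qfund_def coeff_qfund_empty)
    moreover have "(\<Sum>t\<in>shuffles u v. coeff (word_qfund q t) {#}) =
        (\<Sum>t\<in>shuffles u v. if t = [] then 1 else 0)"
      by (simp add: word_qfund_def coeff_qfund_empty)
    ultimately show ?case by simp
  next
    case (block M N a)
    let ?m = "length u" and ?n = "length v"
    note step = coeff_word_qfund_block[OF block.hyps(2,3)]
    define T where "T i j = (\<Sum>x\<in>shuffles (take i u) (take j v). coeff (word_qfund q x) M) *
        (\<Sum>y\<in>shuffles (drop i u) (drop j v). valley_weight q y)" for i j
    have IH: "T i j = coeff (word_qfund q (take i u) * word_qfund q (take j v)) M *
        (valley_weight q (drop i u) * valley_weight q (drop j v))" for i j
    proof -
      have "set (take i u) \<inter> set (take j v) = {}" "set (drop i u) \<inter> set (drop j v) = {}"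
        using block.prems by (auto dest: in_set_takeD in_set_dropD)
      then show ?thesis unfolding T_def by (simp add: block.IH sum_shuffles_valley_weight)
    qed
    \<comment> \<open>The first factor contributes \<open>b\<close> of the \<open>a\<close> copies of \<open>N\<close>, the second one the others.\<close>
    define B where "B = {b. b \<le> a \<and> b \<le> ?m \<and> a - b \<le> ?n}"
    have "coeff (word_qfund q u * word_qfund q v) (M + replicate_mset a N) =
        (\<Sum>b\<le>a. if b \<in> B then T (?m - b) (?n - (a - b)) else 0)"
      unfolding coeff_mult_block[OF block.hyps(3)]
    proof (intro sum.cong refl)
      fix b assume b: "b \<in> {..a}"
      have "(\<Sum>(A, C)\<in>splits M. coeff (word_qfund q u) (A + replicate_mset b N) *
          coeff (word_qfund q v) (C + replicate_mset (a - b) N)) =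
          (\<Sum>(A, C)\<in>splits M. if b \<in> B then
            (valley_weight q (drop (?m - b) u) * valley_weight q (drop (?n - (a - b)) v)) *
            (coeff (word_qfund q (take (?m - b) u)) A * coeff (word_qfund q (take (?n - (a - b)) v)) C)
            else 0)"
      proof (intro sum.cong refl, clarify)
        fix A C assume "(A, C) \<in> splits M"
        then have "\<forall>x\<in>#A. x < N" "\<forall>x\<in>#C. x < N"
          using block.hyps(3) by (auto simp: splits_def)
        note steps = this[THEN coeff_word_qfund_block[OF block.hyps(2)]]
        show "coeff (word_qfund q u) (A + replicate_mset b N) *
          coeff (word_qfund q v) (C + replicate_mset (a - b) N) = (if b \<in> B then
            (valley_weight q (drop (?m - b) u) * valley_weight q (drop (?n - (a - b)) v)) *
            (coeff (word_qfund q (take (?m - b) u)) A * coeff (word_qfund q (take (?n - (a - b)) v)) C)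
            else 0)"
          using b unfolding steps by (auto simp: B_def mult_ac)
      qed
      also have "\<dots> = (if b \<in> B then T (?m - b) (?n - (a - b)) else 0)"
        by (simp add: IH times_power_series.rep_eq split_def mult.commute flip: sum_distrib_left)
      finally show "(\<Sum>(A, C)\<in>splits M. coeff (word_qfund q u) (A + replicate_mset b N) *
          coeff (word_qfund q v) (C + replicate_mset (a - b) N)) =
          (if b \<in> B then T (?m - b) (?n - (a - b)) else 0)" .
    qed
    also have "\<dots> = (\<Sum>b\<in>B. T (?m - b) (?n - (a - b)))"
    proof -
      have "{..a} \<inter> B = B" by (auto simp: B_def)
      then show ?thesis by (simp add: sum.If_cases)
    qed
    also have "\<dots> = (\<Sum>t\<in>shuffles u v. coeff (word_qfund q t) (M + replicate_mset a N))"
    proof (cases "a \<le> ?m + ?n")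
      case True
      define k where "k = ?m + ?n - a"
      have "(\<Sum>t\<in>shuffles u v. coeff (word_qfund q t) (M + replicate_mset a N)) =
          (\<Sum>t\<in>shuffles u v. coeff (word_qfund q (take k t)) M * valley_weight q (drop k t))"
        using True by (intro sum.cong refl) (simp add: step length_shuffles k_def mult.commute)
      also have "\<dots> = (\<Sum>(i, j) | i \<le> ?m \<and> j \<le> ?n \<and> i + j = k. T i j)"
        using sum_shuffles_take_drop[OF block.prems, of k
            "\<lambda>x y. coeff (word_qfund q x) M * valley_weight q y"]
        by (simp add: k_def T_def sum_product)
      also have "\<dots> = (\<Sum>b\<in>B. T (?m - b) (?n - (a - b)))"
        by (rule sum.reindex_bij_witness[of _ "\<lambda>b. (?m - b, ?n - (a - b))" "\<lambda>(i, j). ?m - i"])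
          (use True in \<open>auto simp: B_def k_def intro!: arg_cong[where f = "T _"]\<close>)
      finally show ?thesis by simp
    next
      case False
      then have "B = {}" by (auto simp: B_def)
      then show ?thesis using False by (simp add: step length_shuffles)
    qed
    finally show ?case .
  qed
qed

section \<open>A linear relation for long runs\<close>

text \<open>
  The terms for \<open>Y\<close> and \<open>insert s Y\<close> cancel.
\<close>

lemma alternating_sum_toggle:
  fixes f :: "nat set \<Rightarrow> complex"
  assumes "finite K" "s \<in> K" and f: "\<And>Y. Y \<subseteq> K - {s} \<Longrightarrow> f (insert s Y) = f Y"
  shows "(\<Sum>Y\<in>Pow K. (-1) ^ card Y * f Y) = 0"
proof -
  let ?P = "Pow (K - {s})"
  have "Pow K = ?P \<union> insert s ` ?P"
    using assms(2) Pow_insert[of s "K - {s}"] by (simp add: insert_absorb)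
  moreover have "?P \<inter> insert s ` ?P = {}" by auto
  moreover have "inj_on (insert s) ?P" by (auto simp: inj_on_def)
  ultimately have "(\<Sum>Y\<in>Pow K. (-1) ^ card Y * f Y) =
      (\<Sum>Y\<in>?P. (-1) ^ card Y * f Y) + (\<Sum>Y\<in>?P. (-1) ^ card (insert s Y) * f (insert s Y))"
    using assms(1) by (simp add: sum.union_disjoint sum.reindex)
  also have "(\<Sum>Y\<in>?P. (-1) ^ card (insert s Y) * f (insert s Y)) = - (\<Sum>Y\<in>?P. (-1) ^ card Y * f Y)"
    unfolding sum_negf[symmetric]
  proof (rule sum.cong)
    fix Y assume Y: "Y \<in> ?P"
    then have "finite Y" "s \<notin> Y" using assms(1) finite_subset by auto
    then show "(-1) ^ card (insert s Y) * f (insert s Y) = - ((-1) ^ card Y * f Y)"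
      using Y f by simp
  qed simp
  finally show ?thesis by simp
qed

text \<open>
  The case of \<open>run_relation\<close> in which the indices \<open>k + 1, \<dots>, k + p\<close> lie inside one block. For a
  fixed number \<open>b\<close> of negative entries, the alternating sum vanishes when \<open>s + b\<close> is one of
  these indices, because that index is free. Otherwise the run consists of positive entries only,
  which forces \<open>Y = {}\<close>, or of negative entries only, which forces \<open>Y = {k<..k + p}\<close>. As \<open>k\<close> lies
  in \<open>I\<close> (if it is inside the block) and \<open>k + p + 1\<close> does not, the sign can change only directly
  before or directly after the \<open>p + 1\<close> positions \<open>k + 1, \<dots>, k + p + 1\<close>. The two contributions
  differ by the factor \<open>(-1)\<^sup>p q\<^sup>p\<^sup>+\<^sup>1 = - (- q)\<^sup>p\<^sup>+\<^sup>1 = - 1\<close>.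
\<close>

lemma alternating_block_weight:
  assumes q: "(- q) ^ (p + 1) = 1" and sk: "s \<le> k" and a: "k + p < s + a"
    and k: "s < k \<Longrightarrow> k \<in> I" and I: "I \<inter> {k<..k + p + 1} = {}"
  shows "(\<Sum>Y\<in>Pow {k<..k + p}. (-1) ^ card Y * block_weight q (I \<union> Y) s a) = 0"
proof -
  define K where "K = {k<..k + p}"
  have K: "finite K" "card K = p" by (auto simp: K_def)
  define T where "T b = (\<Sum>Y\<in>Pow K. (-1) ^ card Y * (of_bool (fits (I \<union> Y) s a b) :: complex))" for b
  define m where "m = k - s"
  have m: "k = s + m" using sk by (simp add: m_def)
  define C where "C = (of_bool (fits I s a m) :: complex)"
  have T_only: "T b = (-1) ^ card Z * of_bool (fits (I \<union> Z) s a b)"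
    if "Z \<subseteq> K" "\<And>Y. Y \<subseteq> K \<Longrightarrow> fits (I \<union> Y) s a b \<Longrightarrow> Y = Z" for Z b
  proof -
    have "T b = (\<Sum>Y\<in>Pow K. if Y = Z then (-1) ^ card Z * of_bool (fits (I \<union> Z) s a b) else 0)"
      unfolding T_def using that(2) by (intro sum.cong) auto
    then show ?thesis using that(1) K by simp
  qed
  have T_inside: "T b = 0" if "s + b \<in> K" for b
    unfolding T_def
  proof (rule alternating_sum_toggle[OF K(1) that])
    fix Y assume "Y \<subseteq> K - {s + b}"
    show "of_bool (fits (I \<union> insert (s + b) Y) s a b) = (of_bool (fits (I \<union> Y) s a b) :: complex)"
      by (auto simp: fits_def)
  qed
  have T_left: "T b = of_bool (fits I s a b)" if "b \<le> m" for b
  proof -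
    have "Y = {}" if Y: "Y \<subseteq> K" "fits (I \<union> Y) s a b" for Y
    proof (rule ccontr)
      assume "Y \<noteq> {}"
      then obtain y where y: "y \<in> Y" by blast
      then have "s + (y - s) = y" "y - s \<in> {b<..<a}"
        using subsetD[OF Y(1) y] \<open>b \<le> m\<close> m a by (auto simp: K_def)
      then show False using Y(2) y unfolding fits_def by (metis UnI2)
    qed
    then show ?thesis using T_only[of "{}" b] by simp
  qed
  have T_right: "T b = (-1) ^ p * of_bool (fits (I \<union> K) s a b)" if "b \<ge> m + p + 1" for b
  proof -
    have "Y = K" if Y: "Y \<subseteq> K" "fits (I \<union> Y) s a b" for Y
    proof (rule ccontr)
      assume "Y \<noteq> K"
      then obtain y where y: "y \<in> K" "y \<notin> Y" using Y by blast
      then have "s + (y - s) = y" "y - s \<in> {1..<b}" "y \<notin> I"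
        using \<open>b \<ge> m + p + 1\<close> m I by (auto simp: K_def)
      then show False using Y(2) y unfolding fits_def by (metis Un_iff)
    qed
    then show ?thesis using T_only[of K b] K by simp
  qed
  have T_far_left: "T b = 0" if "b < m" for b
  proof -
    have "k \<in> I" using that m by (intro k) simp
    moreover have "m \<in> {b<..<a}" using that m a by simp
    ultimately have "\<not> fits I s a b" using m unfolding fits_def by blast
    then show ?thesis using T_left[of b] that by simp
  qed
  have T_far_right: "T b = 0" if "b > m + p + 1" for b
  proof -
    have "s + (m + p + 1) \<notin> I \<union> K" using I m by (auto simp: K_def)
    moreover have "m + p + 1 \<in> {1..<b}" using that by simp
    ultimately have "\<not> fits (I \<union> K) s a b" unfolding fits_def by blast
    then show ?thesis using T_right[of b] that by simp
  qed
  have "fits (I \<union> K) s a (m + p + 1) \<longleftrightarrow> fits I s a m"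
  proof -
    have *: "s + i \<in> K \<longleftrightarrow> m < i \<and> i \<le> m + p" for i using m by (auto simp: K_def)
    have **: "s + i \<notin> I" if "m < i" "i \<le> m + p + 1" for i
      using I m that by (auto simp: disjoint_iff)
    have "(\<forall>i\<in>{1..<m + p + 1}. s + i \<in> I \<union> K) \<longleftrightarrow> (\<forall>i\<in>{1..<m}. s + i \<in> I)"
    proof (intro iffI ballI)
      fix i assume A: "\<forall>i\<in>{1..<m + p + 1}. s + i \<in> I \<union> K" "i \<in> {1..<m}"
      then have "s + i \<in> I \<union> K" by simp
      then show "s + i \<in> I" using * A by auto
    next
      fix i assume A: "\<forall>i\<in>{1..<m}. s + i \<in> I" "i \<in> {1..<m + p + 1}"
      consider "i < m" | "i = m" | "i > m" by linarith
      then show "s + i \<in> I \<union> K"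
      proof cases
        case 2
        then have "s < k" using A(2) m by simp
        then show ?thesis using k 2 m by simp
      qed (use A * in auto)
    qed
    moreover have "(\<forall>i\<in>{m + p + 1<..<a}. s + i \<notin> I \<union> K) \<longleftrightarrow> (\<forall>i\<in>{m<..<a}. s + i \<notin> I)"
    proof (intro iffI ballI)
      fix i assume "\<forall>i\<in>{m + p + 1<..<a}. s + i \<notin> I \<union> K" "i \<in> {m<..<a}"
      then show "s + i \<notin> I" using **[of i] by (cases "i \<le> m + p + 1") auto
    qed (use * in auto)
    ultimately show ?thesis by (simp add: fits_def)
  qed
  then have T_ends: "T m = C" "T (m + p + 1) = (-1) ^ p * C"
    using T_left[of m] T_right[of "m + p + 1"] by (simp_all add: C_def)
  have "(\<Sum>Y\<in>Pow K. (-1) ^ card Y * block_weight q (I \<union> Y) s a) = (\<Sum>b\<le>a. q ^ b * T b)"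
    unfolding block_weight_eq_sum T_def sum_distrib_left
    by (subst sum.swap) (simp add: mult.left_commute)
  also have "\<dots> = (\<Sum>b\<in>{m, m + p + 1}. q ^ b * T b)"
  proof (rule sum.mono_neutral_right)
    show "\<forall>b\<in>{..a} - {m, m + p + 1}. q ^ b * T b = 0"
    proof
      fix b assume "b \<in> {..a} - {m, m + p + 1}"
      then consider "b < m" | "s + b \<in> K" | "b > m + p + 1"
        using m by (force simp: K_def)
      then show "q ^ b * T b = 0" using T_far_left T_inside T_far_right by cases auto
    qed
  qed (use a m in auto)
  also have "\<dots> = q ^ m * C * (1 - (- q) ^ (p + 1))"
    using T_ends by (simp add: power_add algebra_simps power_minus[of q])
  finally show ?thesis unfolding q K_def by simp
qed

text \<open>
  The relation behind the spanning property. Its term with the largest index set has all of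
  \<open>k + 1, \<dots>, k + p\<close>, so it rewrites a set that contains a long run in terms of proper subsets.
\<close>

lemma run_relation:
  assumes q: "(- q) ^ (p + 1) = 1" and k: "k \<in> I \<or> k = 0" and I: "I \<inter> {k<..k + p + 1} = {}"
    and n: "k + p < n"
  shows "(\<Sum>Y\<in>Pow {k<..k + p}. (-1) ^ card Y * coeff (qfund q n (I \<union> Y)) M) = 0"
  using n
proof (induction M arbitrary: n rule: monomial_induct)
  case (zero_index M)
  then show ?case by (simp add: coeff_zero_index)
next
  case empty
  then show ?case by (simp add: coeff_qfund_empty)
next
  case (block M N a)
  let ?K = "{k<..k + p}"
  note step = coeff_qfund_block_if[OF block.hyps(2,3)]
  show ?case
  proof (cases "a \<le> n")
    case True
    define s where "s = n - a"
    have n: "n = s + a" "s < n" using True block.hyps(1) by (auto simp: s_def)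
    have sum: "(\<Sum>Y\<in>Pow ?K. (-1) ^ card Y * coeff (qfund q n (I \<union> Y)) (M + replicate_mset a N)) =
        (\<Sum>Y\<in>Pow ?K. (-1) ^ card Y * (block_weight q (I \<union> Y) s a * coeff (qfund q s (I \<union> Y)) M))"
      using True by (simp add: step s_def)
    \<comment> \<open>The toggled indices lie before the last block, or meet its free index \<open>s\<close>, or lie inside it.\<close>
    consider "k + p < s" | "s \<in> ?K" | "s \<le> k" by fastforce
    then show ?thesis
    proof cases
      case 1
      have "block_weight q (I \<union> Y) s a = block_weight q I s a" if "Y \<in> Pow ?K" for Y
        using that 1 by (intro block_weight_cong) auto
      then have "(\<Sum>Y\<in>Pow ?K. (-1) ^ card Y * (block_weight q (I \<union> Y) s a * coeff (qfund q s (I \<union> Y)) M)) =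
          block_weight q I s a * (\<Sum>Y\<in>Pow ?K. (-1) ^ card Y * coeff (qfund q s (I \<union> Y)) M)"
        unfolding sum_distrib_left by (intro sum.cong) (auto simp: mult.left_commute)
      then show ?thesis using sum block.IH[OF 1] by simp
    next
      case 2
      have "block_weight q (I \<union> insert s Y) s a = block_weight q (I \<union> Y) s a"
        "qfund q s (I \<union> insert s Y) = qfund q s (I \<union> Y)" for Y
        by (auto intro!: block_weight_cong qfund_cong)
      then show ?thesis unfolding sum by (intro alternating_sum_toggle[OF _ 2]) auto
    next
      case 3
      have "qfund q s (I \<union> Y) = qfund q s I" if "Y \<in> Pow ?K" for Y
        using that 3 by (intro qfund_cong) auto
      then have "(\<Sum>Y\<in>Pow ?K. (-1) ^ card Y * (block_weight q (I \<union> Y) s a * coeff (qfund q s (I \<union> Y)) M)) =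
          coeff (qfund q s I) M * (\<Sum>Y\<in>Pow ?K. (-1) ^ card Y * block_weight q (I \<union> Y) s a)"
        unfolding sum_distrib_left by (intro sum.cong) (auto simp: ac_simps)
      moreover have "(\<Sum>Y\<in>Pow ?K. (-1) ^ card Y * block_weight q (I \<union> Y) s a) = 0"
        using block.prems n k by (intro alternating_block_weight[OF q 3 _ _ I]) auto
      ultimately show ?thesis using sum by simp
    qed
  qed (simp add: step)
qed

section \<open>Roots of unity and spanning\<close>

lemma minus_rho: "- rho p = cis (2 * pi / (real p + 1))"
proof -
  have "- rho p = cis pi * cis (- (pi * (real p - 1) / (real p + 1)))"
    by (simp add: rho_def cis_conv_exp mult.assoc)
  also have "\<dots> = cis (2 * pi / (real p + 1))"
    unfolding cis_mult by (rule arg_cong[of _ _ cis]) (simp add: field_simps)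
  finally show ?thesis .
qed

text \<open>
  The order of this root of unity enters twice: the power \<open>p + 1\<close> is \<open>1\<close>, which gives the relation for
  long runs, and the smaller powers are not, which gives linear independence.
\<close>

lemma minus_rho_power_eq_1_iff: "(- rho p) ^ m = 1 \<longleftrightarrow> p + 1 dvd m"
proof -
  let ?x = "real m * (2 * pi / (real p + 1))"
  have "(- rho p) ^ m = 1 \<longleftrightarrow> cis ?x = 1"
    unfolding minus_rho Complex.DeMoivre ..
  also have "\<dots> \<longleftrightarrow> cos ?x = 1"
  proof
    assume "cos ?x = 1"
    moreover from this have "sin ?x = 0" using sin_cos_squared_add[of ?x] by simp
    ultimately show "cis ?x = 1" by (simp add: complex_eq_iff)
  qed (simp add: complex_eq_iff)
  also have "\<dots> \<longleftrightarrow> (\<exists>j::int. int m = j * int (p + 1))"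
  proof -
    have "?x = of_int j * 2 * pi \<longleftrightarrow> int m = j * int (p + 1)" for j :: int
    proof -
      have "?x = of_int j * 2 * pi \<longleftrightarrow> real m = of_int j * (real p + 1)"
      proof -
        have "?x = real m / (real p + 1) * (2 * pi)" "of_int j * 2 * pi = of_int j * (2 * pi)"
          by simp_all
        moreover have "2 * pi \<noteq> 0" by simp
        ultimately have "?x = of_int j * 2 * pi \<longleftrightarrow> real m / (real p + 1) = of_int j"
          by (metis mult_right_cancel)
        then show ?thesis by (simp add: divide_eq_eq)
      qed
      also have "\<dots> \<longleftrightarrow> real_of_int (int m) = real_of_int (j * int (p + 1))"
        by (simp add: add.commute)
      finally show ?thesis by (simp only: of_int_eq_iff)
    qed
    then show ?thesis by (simp only: cos_one_2pi_int)
  qed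
  also have "\<dots> \<longleftrightarrow> p + 1 dvd m"
    unfolding int_dvd_int_iff[symmetric] dvd_def by (simp add: mult.commute)
  finally show ?thesis .
qed

text \<open>
  The upper end of the run has to be maximal because \<open>run_relation\<close> needs an index outside of the
  set after the run.
\<close>

lemma ext_peak_set_maximal_run:
  assumes "I \<subseteq> {1..<n}" "\<not> ext_peak_set p n I" "p \<ge> 1"
  obtains k where "{k..k + p} \<subseteq> I \<union> {0}" "k + p + 1 \<notin> I" "k + p < n"
proof -
  define A where "A = {k. {k..k + p} \<subseteq> I \<union> {0}}"
  have bound: "k + p < n" if "k \<in> A" for k
  proof -
    have "k + p \<in> I \<union> {0}" using that subsetD[of "{k..k + p}" "I \<union> {0}" "k + p"] by (simp add: A_def)
    then have "k + p \<in> I" using assms(3) by simp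
    then show ?thesis using assms(1) by auto
  qed
  have "finite A" by (rule finite_subset[of _ "{..n}"]) (use bound in fastforce)+
  moreover have "A \<noteq> {}" using assms by (auto simp: ext_peak_set_def A_def)
  moreover have "Suc (Max A) \<notin> A" if "finite A"
    using Max_ge[OF that, of "Suc (Max A)"] by (meson Suc_n_not_le_n)
  ultimately have max: "Max A \<in> A" "Suc (Max A) \<notin> A" by simp_all
  show thesis
  proof
    show run: "{Max A..Max A + p} \<subseteq> I \<union> {0}" using max by (simp add: A_def)
    show "Max A + p + 1 \<notin> I"
    proof
      assume "Max A + p + 1 \<in> I"
      then have "{Suc (Max A)..Suc (Max A) + p} \<subseteq> I \<union> {0}"
      proof -
        have "{Suc (Max A)..Suc (Max A) + p} \<subseteq> insert (Max A + p + 1) {Max A..Max A + p}" by auto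
        then show ?thesis using run \<open>Max A + p + 1 \<in> I\<close> by blast
      qed
      then show False using max by (simp add: A_def)
    qed
    show "Max A + p < n" using max bound by blast
  qed
qed

text \<open>
  The relation for a maximal long run leads to proper subsets, so the rewriting terminates.
\<close>

lemma ext_peak_fun_in_span:
  assumes p: "p \<ge> 1" and I: "I \<subseteq> {1..<n}"
  shows "ext_peak_fun p n I \<in> PS.span ((\<lambda>(n, I). ext_peak_fun p n I) ` {(n, I). ext_peak_set p n I})"
    (is "_ \<in> PS.span ?B")
  using I
proof (induction "card I" arbitrary: I rule: less_induct)
  case less
  have fin: "finite I" using less.prems finite_subset by blast
  show ?case
  proof (cases "ext_peak_set p n I")
    case True
    then show ?thesis by (intro PS.span_base) auto
  next
    case False
    then obtain k where k: "{k..k + p} \<subseteq> I \<union> {0}" "k + p + 1 \<notin> I" "k + p < n"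
      using ext_peak_set_maximal_run[OF less.prems _ p] by blast
    define K where "K = {k<..k + p}"
    define J where "J = I - K"
    have K: "finite K" "card K = p" "K \<subseteq> I"
    proof -
      have "K \<subseteq> {k..k + p}" "0 \<notin> K" by (auto simp: K_def)
      then show "K \<subseteq> I" using k(1) by blast
    qed (simp_all add: K_def)
    have IJ: "I = J \<union> K" using K by (auto simp: J_def)
    have "k \<in> J \<or> k = 0" using subsetD[OF k(1), of k] by (auto simp: J_def K_def)
    moreover have "J \<inter> {k<..k + p + 1} = {}" using k(2) by (auto simp: J_def K_def le_Suc_eq)
    moreover have "(- rho p) ^ (p + 1) = 1" by (simp only: minus_rho_power_eq_1_iff dvd_refl)
    ultimately have relation:
      "(\<Sum>Y\<in>Pow K. (-1) ^ card Y * coeff (ext_peak_fun p n (J \<union> Y)) M) = 0" for M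
      using run_relation[of "rho p" p k J n M] k(3) by (simp add: ext_peak_fun_def K_def)
    have "ext_peak_fun p n I =
      (\<Sum>Y\<in>Pow K - {K}. scale (- ((-1) ^ p) * (-1) ^ card Y) (ext_peak_fun p n (J \<union> Y)))"
    proof (rule coeff_eqI)
      fix M
      let ?c = "\<lambda>Y. coeff (ext_peak_fun p n (J \<union> Y)) M"
      \<comment> \<open>Since \<open>(-1)\<^sup>p\<close> is its own inverse, the relation can be solved for the term of \<open>K\<close>.\<close>
      have "(-1) ^ p * ?c K + (\<Sum>Y\<in>Pow K - {K}. (-1) ^ card Y * ?c Y) = 0"
        using relation[of M] K by (simp add: sum.remove[of "Pow K" K])
      then have "(-1) ^ p * ((-1) ^ p * ?c K) = - ((-1) ^ p * (\<Sum>Y\<in>Pow K - {K}. (-1) ^ card Y * ?c Y))"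
        by (simp add: add_eq_0_iff2)
      then have "?c K = - ((-1) ^ p * (\<Sum>Y\<in>Pow K - {K}. (-1) ^ card Y * ?c Y))"
        by (simp flip: mult.assoc power_add mult_2)
      then show "coeff (ext_peak_fun p n I) M = coeff (\<Sum>Y\<in>Pow K - {K}.
          scale (- ((-1) ^ p) * (-1) ^ card Y) (ext_peak_fun p n (J \<union> Y))) M"
        unfolding coeff_sum coeff_scale IJ by (simp add: sum_distrib_left sum_negf mult.assoc)
    qed
    also have "\<dots> \<in> PS.span ?B"
    proof (intro PS.span_sum PS.span_scale)
      fix Y assume Y: "Y \<in> Pow K - {K}"
      moreover have "J \<inter> K = {}" by (auto simp: J_def)
      ultimately have "J \<union> Y \<subset> I" using IJ by blast
      then show "ext_peak_fun p n (J \<union> Y) \<in> PS.span ?B"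
        using fin less.prems by (intro less.hyps psubset_card_mono) auto
    qed
    finally show ?thesis .
  qed
qed

section \<open>Linear independence\<close>

text \<open>
  Inside the block, \<open>I\<close> has to be an initial segment. Its length is \<open>b\<close> or \<open>b - 1\<close>, depending on
  whether it contains the free index \<open>s + b\<close>.
\<close>

lemma fits_iff_interval:
  assumes "b \<le> a" "0 < a"
  shows "fits I s a b \<longleftrightarrow> (b < a \<and> I \<inter> {s<..<s + a} = {s<..<s + 1 + b}) \<or>
    (1 \<le> b \<and> I \<inter> {s<..<s + a} = {s<..<s + b})"
proof -
  have fits: "fits I s a b \<longleftrightarrow> {s<..<s + b} \<subseteq> I \<and> I \<inter> {s + b<..<s + a} = {}"
  proof -
    have 1: "(\<lambda>i. s + i) ` {1..<b} = {s<..<s + b}" 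
      by (simp add: add.commute flip: atLeastSucLessThan_greaterThanLessThan)
    have 2: "(\<lambda>i. s + i) ` {b<..<a} = {s + b<..<s + a}"
      by (simp add: add.commute flip: atLeastSucLessThan_greaterThanLessThan)
    show ?thesis unfolding fits_def 1[symmetric] 2[symmetric] image_subset_iff by blast
  qed
  show ?thesis
  proof
    assume "fits I s a b"
    then have f: "{s<..<s + b} \<subseteq> I" "I \<inter> {s + b<..<s + a} = {}" by (simp_all add: fits)
    show "(b < a \<and> I \<inter> {s<..<s + a} = {s<..<s + 1 + b}) \<or>
      (1 \<le> b \<and> I \<inter> {s<..<s + a} = {s<..<s + b})"
    proof (cases "b < a \<and> (b = 0 \<or> s + b \<in> I)")
      case True
      have "I \<inter> {s<..<s + a} = {s<..<s + 1 + b}"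
      proof (intro equalityI subsetI)
        fix x assume "x \<in> I \<inter> {s<..<s + a}"
        then show "x \<in> {s<..<s + 1 + b}" using f(2) by (force simp: not_le)
      next
        fix x assume x: "x \<in> {s<..<s + 1 + b}"
        then have "x \<in> I" using f(1) True by (cases "x = s + b") auto
        then show "x \<in> I \<inter> {s<..<s + a}" using x True by auto
      qed
      then show ?thesis using True by blast
    next
      case False
      have "I \<inter> {s<..<s + a} = {s<..<s + b}"
      proof (intro equalityI subsetI)
        fix x assume x: "x \<in> I \<inter> {s<..<s + a}"
        then have "x \<noteq> s + b" using False by auto
        then show "x \<in> {s<..<s + b}" using f(2) x by (force simp: not_less)
      next
        fix x assume x: "x \<in> {s<..<s + b}"
        then show "x \<in> I \<inter> {s<..<s + a}" using f(1) assms by auto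
      qed
      moreover have "1 \<le> b" using False assms by (cases "b = 0") simp_all
      ultimately show ?thesis by blast
    qed
  next
    assume A: "(b < a \<and> I \<inter> {s<..<s + a} = {s<..<s + 1 + b}) \<or>
      (1 \<le> b \<and> I \<inter> {s<..<s + a} = {s<..<s + b})"
    have *: "{s<..<s + b} \<subseteq> {s<..<s + 1 + b}" "{s<..<s + 1 + b} \<inter> {s + b<..<s + a} = {}"
      "{s + b<..<s + a} \<subseteq> {s<..<s + a}" by auto
    show "fits I s a b" unfolding fits using A * by blast
  qed
qed

lemma block_weight_interval:
  assumes "0 < a"
  shows "block_weight q I s a =
    (1 + q) * (\<Sum>c<a. q ^ c * of_bool (I \<inter> {s<..<s + a} = {s<..<s + 1 + c}))"
proof -
  obtain d where d: "a = Suc d" using assms gr0_implies_Suc by blast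
  define E where "E c = (of_bool (I \<inter> {s<..<s + a} = {s<..<s + 1 + c}) :: complex)" for c
  define E' where "E' b = (of_bool (1 \<le> b \<and> I \<inter> {s<..<s + a} = {s<..<s + b}) :: complex)" for b
  have "of_bool (fits I s a b) = of_bool (b < a) * E b + E' b" if "b \<le> a" for b
  proof -
    have "{s<..<s + 1 + b} \<noteq> {s<..<s + b}" if "1 \<le> b"
    proof -
      have "s + b \<in> {s<..<s + 1 + b}" using that by simp
      then show ?thesis by (metis greaterThanLessThan_iff less_irrefl)
    qed
    then show ?thesis unfolding fits_iff_interval[OF that assms] E_def E'_def by auto
  qed
  then have "block_weight q I s a = (\<Sum>b\<le>a. q ^ b * (of_bool (b < a) * E b + E' b))"
    unfolding block_weight_eq_sum by (intro sum.cong) auto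
  also have "\<dots> = (\<Sum>b\<le>a. q ^ b * (of_bool (b < a) * E b)) + (\<Sum>b\<le>a. q ^ b * E' b)"
    by (simp add: sum.distrib algebra_simps)
  also have "(\<Sum>b\<le>a. q ^ b * (of_bool (b < a) * E b)) = (\<Sum>c<a. q ^ c * E c)"
    unfolding d lessThan_Suc_atMost by (simp add: le_imp_less_Suc)
  also have "(\<Sum>b\<le>a. q ^ b * E' b) = q * (\<Sum>c<a. q ^ c * E c)"
    unfolding d sum.atMost_Suc_shift lessThan_Suc_atMost sum_distrib_left
    by (simp add: E_def E'_def d mult.assoc)
  finally show ?thesis by (simp add: E_def algebra_simps)
qed

text \<open>
  Let \<open>S s = (\<Sum>c\<le>n - s. q ^ c * a (P \<union> {s..<s + c}))\<close>. The relation for \<open>s\<close> says that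
  \<open>S s = a P + (- q) * S (s + 1)\<close>, and \<open>S n = a P\<close>; so \<open>S s\<close> is \<open>a P\<close> times a geometric sum.
\<close>

lemma run_sum:
  fixes a :: "nat set \<Rightarrow> complex"
  assumes rel: "\<And>s P. s < n \<Longrightarrow> P \<subseteq> {1..<s} \<Longrightarrow>
      (\<Sum>c<n - s. q ^ c * (a (P \<union> {s<..<s + 1 + c}) + a (P \<union> {s..<s + 1 + c}))) = 0"
    and "s \<le> n" "P \<subseteq> {1..<s}"
  shows "(\<Sum>c\<le>n - s. q ^ c * a (P \<union> {s..<s + c})) = a P * (\<Sum>i\<le>n - s. (- q) ^ i)"
  using assms(2,3)
proof (induction "n - s" arbitrary: s)
  case 0
  then show ?case by simp
next
  case (Suc d)
  then have d: "n - s = Suc d" "d = n - Suc s" "s < n" by simp_all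
  let ?A = "\<Sum>c\<le>d. q ^ c * a (P \<union> {Suc s..<Suc s + c})"
  let ?B = "\<Sum>c\<le>d. q ^ c * a (P \<union> {s..<s + Suc c})"
  have A: "?A = a P * (\<Sum>i\<le>d. (- q) ^ i)"
  proof -
    have "P \<subseteq> {1..<Suc s}" using Suc.prems(2) by auto
    then show ?thesis using Suc.hyps(1)[OF d(2)] d(3) unfolding d(2)[symmetric] by simp
  qed
  have "?B = - ?A"
  proof -
    have "?A + ?B = 0"
      using rel[OF d(3) Suc.prems(2)] unfolding d(1) lessThan_Suc_atMost
      by (simp add: sum.distrib distrib_left atLeastSucLessThan_greaterThanLessThan)
    then show ?thesis by (rule iffD1[OF add_eq_0_iff])
  qed
  then have "?B = - (a P * (\<Sum>i\<le>d. (- q) ^ i))" by (simp only: A)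
  then have "a P + q * ?B = a P * (1 + (- q) * (\<Sum>i\<le>d. (- q) ^ i))"
    by (simp add: algebra_simps)
  then show ?case
    unfolding d(1) sum.atMost_Suc_shift sum_distrib_left
    by (simp add: mult.assoc)
qed

text \<open>
  Apart from its first term, the sum for \<open>(s, P)\<close> in \<open>run_sum\<close> is \<open>q\<close> times the sum for
  \<open>(s + 1, insert s P)\<close>. Comparing the two closed forms gives
  \<open>(a P + a (insert s P)) * (\<Sum>i<n - s. (- q) ^ i) = 0\<close>, and the geometric sum is nonzero
  unless \<open>(- q) ^ (n - s) = 1\<close>. For \<open>s = 0\<close> the set \<open>insert s P\<close> is not a set of positive indices;
  the assumption that \<open>a\<close> vanishes there is what makes the statement true in this case.
\<close>

lemma toggle_top:
  fixes a :: "nat set \<Rightarrow> complex"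
  assumes rel: "\<And>s P. s < n \<Longrightarrow> P \<subseteq> {1..<s} \<Longrightarrow>
      (\<Sum>c<n - s. q ^ c * (a (P \<union> {s<..<s + 1 + c}) + a (P \<union> {s..<s + 1 + c}))) = 0"
    and zero: "\<And>I. 0 \<in> I \<Longrightarrow> a I = 0"
    and s: "s < n" and P: "P \<subseteq> {1..<s}" and q: "q \<noteq> 0" "(- q) ^ (n - s) \<noteq> 1"
  shows "a (insert s P) = - a P"
proof -
  obtain d where d: "n - s = Suc d" using s by (metis Suc_diff_Suc)
  define G where "G = (\<Sum>i\<le>d. (- q) ^ i)"
  have "(- q - 1) * G = (- q) ^ (n - s) - 1"
    unfolding G_def d by (metis lessThan_Suc_atMost power_diff_1_eq)
  then have G: "G \<noteq> 0" using q(2) by auto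
  have "(\<Sum>i\<le>n - s. (- q) ^ i) = 1 - q * G"
    unfolding d sum.atMost_Suc_shift G_def by (simp add: sum_distrib_left sum_negf)
  then have low: "(\<Sum>c\<le>n - s. q ^ c * a (P \<union> {s..<s + c})) = a P * (1 - q * G)"
    using run_sum[OF rel less_imp_le[OF s] P] by simp
  have high: "(\<Sum>c\<le>n - s. q ^ c * a (P \<union> {s..<s + c})) = a P + q * (a (insert s P) * G)"
  proof (cases "s = 0")
    case True
    then have "a (insert s P) = 0" "P = {}" using zero P by auto
    moreover have "a ({s..<s + Suc c}) = 0" for c using zero True by simp
    ultimately show ?thesis unfolding d sum.atMost_Suc_shift by simp
  next
    case False
    then have "insert s P \<subseteq> {1..<Suc s}" using P by auto
    from run_sum[OF rel Suc_leI[OF s] this]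
    have "(\<Sum>c\<le>d. q ^ c * a (insert s P \<union> {Suc s..<Suc s + c})) = a (insert s P) * G"
      using d by (simp add: G_def diff_Suc)
    moreover have "insert s P \<union> {Suc s..<Suc s + c} = P \<union> {s..<s + Suc c}" for c
      by auto
    ultimately show ?thesis
      unfolding d sum.atMost_Suc_shift by (simp add: mult.assoc flip: sum_distrib_left)
  qed
  have "q * G * (a P + a (insert s P)) = 0"
    using low high by (simp add: algebra_simps)
  then show ?thesis using q G by (simp add: eq_neg_iff_add_eq_0 add.commute)
qed

text \<open>
  By the toggling rule, an index above all the others can be added or removed at the cost of a sign,
  unless its distance to \<open>n\<close> is a multiple of \<open>p + 1\<close>. Let \<open>m\<close> be the largest element of
  \<open>insert 0 I\<close>. If the distance from \<open>m\<close> to \<open>n\<close> is not such a multiple, \<open>m\<close> can be toggled: either it is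
  removed from \<open>I\<close> and induction applies, or \<open>I\<close> is empty and toggling \<open>m = 0\<close> gives the set \<open>{0}\<close>,
  on which \<open>a\<close> vanishes. If the distance is such a multiple, the \<open>p\<close> numbers after \<open>m\<close> are smaller
  than \<open>n\<close> and not exceptional, so all of them can be added; together with \<open>m\<close> they form a run
  of \<open>p + 1\<close> numbers, and \<open>a\<close> vanishes on the set obtained.
\<close>

lemma vanish_if_supported_on_ext_peak_sets:
  fixes a :: "nat set \<Rightarrow> complex"
  assumes supp: "\<And>I. \<not> ext_peak_set p n I \<Longrightarrow> a I = 0" and n: "n > 0"
    and toggle: "\<And>s P. s < n \<Longrightarrow> P \<subseteq> {1..<s} \<Longrightarrow> \<not> p + 1 dvd n - s \<Longrightarrow> a (insert s P) = - a P"
  shows "a I = 0"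
proof (cases "ext_peak_set p n I")
  case True
  then show ?thesis
  proof (induction "card I" arbitrary: I rule: less_induct)
    case less
    then have I: "I \<subseteq> {1..<n}" "finite I" using finite_subset by (auto simp: ext_peak_set_def)
    define m where "m = Max (insert 0 I)"
    have m: "m \<in> insert 0 I" "\<forall>x\<in>I. x \<le> m"
      using I Max_in[of "insert 0 I"] by (auto simp: m_def)
    then have "m < n" using I n by auto
    show ?case
    proof (cases "p + 1 dvd n - m")
      case False
      define P where "P = I - {m}"
      have "P \<subseteq> {1..<m}" using I m by (fastforce simp: P_def)
      from toggle[OF \<open>m < n\<close> this False] have t: "a (insert m P) = - a P" .
      show ?thesis
      proof (cases "m \<in> I")
        case True
        then have "a I = - a P" "card P < card I"
          using t card_Diff1_less[OF I(2) True] by (simp_all add: P_def insert_absorb)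
        then show ?thesis using less.hyps supp by fastforce
      next
        case False
        then have "m = 0" "P = I" using m by (auto simp: P_def)
        moreover have "a (insert m P) = 0"
          using \<open>m = 0\<close> by (intro supp) (auto simp: ext_peak_set_def)
        ultimately show ?thesis using t by simp
      qed
    next
      case True
      then have big: "m + p < n" using \<open>m < n\<close> dvd_imp_le[of "p + 1" "n - m"] by auto
      have "a (I \<union> {m<..m + j}) = (-1) ^ j * a I" if "j \<le> p" for j
        using that
      proof (induction j)
        case (Suc j)
        let ?s = "m + Suc j"
        have "\<not> p + 1 dvd n - ?s"
        proof
          assume "p + 1 dvd n - ?s"
          then have "p + 1 dvd (n - m) - (n - ?s)" using True by (rule dvd_diff_nat[rotated])
          moreover have "(n - m) - (n - ?s) = Suc j" using big Suc.prems by simp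
          ultimately have "p + 1 \<le> Suc j" using dvd_imp_le[of "p + 1" "Suc j"] by simp
          then show False using Suc.prems by simp
        qed
        moreover have "I \<union> {m<..m + j} \<subseteq> {1..<?s}" using I m by fastforce
        moreover have "?s < n" using big Suc.prems by simp
        ultimately have "a (insert ?s (I \<union> {m<..m + j})) = - a (I \<union> {m<..m + j})"
          using toggle by blast
        moreover have "I \<union> {m<..m + Suc j} = insert ?s (I \<union> {m<..m + j})" by auto
        ultimately show ?case using Suc by simp
      qed simp
      then have "a (I \<union> {m<..m + p}) = (-1) ^ p * a I" by simp
      moreover have "{m..m + p} \<subseteq> (I \<union> {m<..m + p}) \<union> {0}" using m by fastforce
      then have "a (I \<union> {m<..m + p}) = 0" by (intro supp) (auto simp: ext_peak_set_def)
      ultimately show ?thesis by simp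
    qed
  qed
qed (rule supp)

lemma ext_peak_set_prefix: "ext_peak_set p n I \<Longrightarrow> ext_peak_set p s (I \<inter> {1..<s})"
  unfolding ext_peak_set_def by blast

text \<open>
  Extracting the coefficients of the monomials \<open>M x\<^sub>N\<^sup>n\<^sup>-\<^sup>s\<close> turns a linear relation in degree \<open>n\<close> into one
  in degree \<open>s\<close> among the functions of the truncated sets \<open>I \<inter> {1..<s}\<close>, which are again extended
  peak sets. By induction its coefficients vanish, and these equations are the ones that
  \<open>toggle_top\<close> needs.
\<close>

lemma ext_peak_fun_coeffs_independent:
  fixes a :: "nat set \<Rightarrow> complex"
  assumes p: "p \<ge> 1"
    and supp: "\<And>I. \<not> ext_peak_set p n I \<Longrightarrow> a I = 0"
    and rel: "\<And>M. (\<Sum>I\<in>Pow {1..<n}. a I * coeff (ext_peak_fun p n I) M) = 0"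
  shows "a I = 0"
  using supp rel
proof (induction n arbitrary: a I rule: less_induct)
  case (less n)
  note supp = less.prems(1) and rel = less.prems(2)
  define q where "q = rho p"
  have q: "(- q) ^ m = 1 \<longleftrightarrow> p + 1 dvd m" for m
    unfolding q_def by (rule minus_rho_power_eq_1_iff)
  have "q \<noteq> 0" using q[of "p + 1"] by auto
  moreover have "1 + q \<noteq> 0" using q[of 1] p by (auto simp: add_eq_0_iff)
  ultimately have q0: "q \<noteq> 0" "1 + q \<noteq> 0" .
  show ?case
  proof (cases "n = 0")
    case True
    have "a {} = 0" using rel[of "{#}"] True by (simp add: ext_peak_fun_def coeff_qfund_empty)
    then show ?thesis using supp[of I] True by (cases "I = {}") (auto simp: ext_peak_set_def)
  next
    case False
    have zero: "a I = 0" if "0 \<in> I" for I using that by (intro supp) (auto simp: ext_peak_set_def)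
    have "(\<Sum>c<n - s. q ^ c * (a (P \<union> {s<..<s + 1 + c}) + a (P \<union> {s..<s + 1 + c}))) = 0"
      if s: "s < n" and P: "P \<subseteq> {1..<s}" for s P
    proof -
      define w where "w I = block_weight q I s (n - s)" for I
      define F where "F P = {I \<in> Pow {1..<n}. I \<inter> {1..<s} = P}" for P
      define a' where "a' P = (\<Sum>I\<in>F P. a I * w I)" for P
      have fin: "finite (F P)" for P by (simp add: F_def)
      have "a' P = 0"
      proof (rule less.IH[OF s])
        fix P assume "\<not> ext_peak_set p s P"
        then have "\<forall>I\<in>F P. a I = 0"
          using supp ext_peak_set_prefix unfolding F_def by blast
        then show "a' P = 0" by (simp add: a'_def)
      next
        fix M
        \<comment> \<open>Any index above those in \<open>M\<close> will do.\<close>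
        define N where "N = Suc (Max (insert 0 (set_mset M)))"
        have N: "N > 0" "\<forall>x\<in>#M. x < N" by (auto simp: N_def less_Suc_eq_le)
        have "0 = (\<Sum>I\<in>Pow {1..<n}. a I * coeff (ext_peak_fun p n I) (M + replicate_mset (n - s) N))"
          using rel by simp
        also have "\<dots> = (\<Sum>I\<in>Pow {1..<n}. a I * w I * coeff (ext_peak_fun p s I) M)"
          using s by (simp add: ext_peak_fun_def coeff_qfund_block[OF N] w_def q_def mult.assoc)
        also have "\<dots> = (\<Sum>P\<in>Pow {1..<s}. \<Sum>I\<in>F P. a I * w I * coeff (ext_peak_fun p s I) M)"
          unfolding F_def by (rule sum.group[symmetric]) auto
        also have "\<dots> = (\<Sum>P\<in>Pow {1..<s}. a' P * coeff (ext_peak_fun p s P) M)"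
          unfolding a'_def sum_distrib_right
        proof (intro sum.cong refl)
          fix P I assume "I \<in> F P"
          then have "qfund (rho p) s I = qfund (rho p) s P"
            by (intro qfund_cong) (auto simp: F_def)
          then show "a I * w I * coeff (ext_peak_fun p s I) M = a I * w I * coeff (ext_peak_fun p s P) M"
            by (simp add: ext_peak_fun_def)
        qed
        finally show "(\<Sum>P\<in>Pow {1..<s}. a' P * coeff (ext_peak_fun p s P) M) = 0" by simp
      qed
      \<comment> \<open>The sets that agree with \<open>P\<close> below \<open>s\<close> and with \<open>Q\<close> above \<open>s\<close> differ only in the index \<open>s\<close>.\<close>
      have inner: "(\<Sum>I\<in>F P. a I * of_bool (I \<inter> {s<..<n} = Q)) = a (P \<union> Q) + a (insert s (P \<union> Q))"
        if Q: "Q \<subseteq> {s<..<n}" for Q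
      proof -
        have sub: "I \<in> {P \<union> Q, insert s (P \<union> Q)}" if "I \<in> F P" "I \<inter> {s<..<n} = Q" for I
        proof -
          have "I = I \<inter> {1..<s} \<union> (I \<inter> {s}) \<union> I \<inter> {s<..<n}"
            using that(1) by (auto simp: F_def)
          also have "\<dots> = P \<union> (I \<inter> {s}) \<union> Q" using that by (simp add: F_def)
          finally show ?thesis by (cases "s \<in> I") auto
        qed
        have Q': "(P \<union> Q) \<inter> {s<..<n} = Q" "insert s (P \<union> Q) \<inter> {s<..<n} = Q"
          "P \<union> Q \<noteq> insert s (P \<union> Q)"
        proof -
          have "s \<notin> P \<union> Q" using P Q by auto
          then show "P \<union> Q \<noteq> insert s (P \<union> Q)" by blast
        qed (use P Q in auto)
        have "P \<union> Q \<in> F P" using P Q s by (auto simp: F_def)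
        have "(\<Sum>I\<in>F P. a I * of_bool (I \<inter> {s<..<n} = Q)) =
            (\<Sum>I\<in>F P \<inter> {P \<union> Q, insert s (P \<union> Q)}. a I * of_bool (I \<inter> {s<..<n} = Q))"
          using sub fin by (intro sum.mono_neutral_right) auto
        also have "\<dots> = (\<Sum>I\<in>{P \<union> Q, insert s (P \<union> Q)}. a I * of_bool (I \<inter> {s<..<n} = Q))"
        proof (rule sum.mono_neutral_left)
          have "a (insert s (P \<union> Q)) = 0" if "insert s (P \<union> Q) \<notin> F P"
          proof -
            have "s = 0" using that P Q s by (auto simp: F_def)
            then show ?thesis by (intro zero) simp
          qed
          then show "\<forall>I\<in>{P \<union> Q, insert s (P \<union> Q)} - F P \<inter> {P \<union> Q, insert s (P \<union> Q)}.
              a I * of_bool (I \<inter> {s<..<n} = Q) = 0"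
            using \<open>P \<union> Q \<in> F P\<close> by auto
        qed auto
        also have "\<dots> = a (P \<union> Q) + a (insert s (P \<union> Q))" using Q' by simp
        finally show ?thesis .
      qed
      have "a' P = (1 + q) * (\<Sum>c<n - s. q ^ c * (\<Sum>I\<in>F P. a I * of_bool (I \<inter> {s<..<n} = {s<..<s + 1 + c})))"
        using s unfolding a'_def w_def sum_distrib_left
        by (subst sum.swap) (simp add: block_weight_interval sum_distrib_left ac_simps
            del: sum_mult_of_bool_eq sum_of_bool_mult_eq)
      also have "\<dots> = (1 + q) * (\<Sum>c<n - s. q ^ c * (a (P \<union> {s<..<s + 1 + c}) + a (P \<union> {s..<s + 1 + c})))"
      proof -
        have "insert s (P \<union> {s<..<s + 1 + c}) = P \<union> {s..<s + 1 + c}" for c by auto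
        then have "(\<Sum>I\<in>F P. a I * of_bool (I \<inter> {s<..<n} = {s<..<s + 1 + c})) =
            a (P \<union> {s<..<s + 1 + c}) + a (P \<union> {s..<s + 1 + c})" if "c < n - s" for c
          using that by (subst inner) auto
        then show ?thesis by simp
      qed
      finally show ?thesis using \<open>a' P = 0\<close> q0 by simp
    qed
    then have "a (insert s P) = - a P" if "s < n" "P \<subseteq> {1..<s}" "\<not> p + 1 dvd n - s" for s P
      using toggle_top[of n q a, OF _ zero that(1,2) q0(1)] that(3) q by blast
    then show ?thesis
      using vanish_if_supported_on_ext_peak_sets[of p n a I, OF supp] False by blast
  qed
qed

section \<open>The algebra of extended peaks and its basis\<close>

lemma scale_mult_left: "scale c f * g = scale c (f * g)"
  by (rule coeff_eqI) (simp add: times_power_series.rep_eq coeff_scale sum_distrib_left split_def mult.assoc)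

text \<open>
  It suffices to multiply generators, as multiplication is bilinear.
\<close>

lemma span_mult_closed:
  assumes gen: "\<And>f g. f \<in> B \<Longrightarrow> g \<in> B \<Longrightarrow> f * g \<in> PS.span B"
    and "f \<in> PS.span B" "g \<in> PS.span B"
  shows "f * g \<in> PS.span B"
proof -
  have sub: "PS.subspace {f. f * g \<in> PS.span B}" for g
    unfolding PS.subspace_def
    by (auto simp: distrib_right scale_mult_left PS.span_zero PS.span_add PS.span_scale)
  have step: "f * g \<in> PS.span B" if "f \<in> B" "g \<in> PS.span B" for f g
  proof -
    have "g * f \<in> PS.span B"
      using that(2) sub by (rule PS.span_induct) (use gen that(1) in blast)
    then show ?thesis by (simp add: mult.commute)
  qed
  show ?thesis by (rule PS.span_induct[OF assms(2) sub]) (rule step[OF _ assms(3)])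
qed

text \<open>
  Linear independence of the family, as opposed to that of its range, includes injectivity.
\<close>

lemma is_basis_familyI:
  assumes indep: "\<And>T u. finite T \<Longrightarrow> T \<subseteq> S \<Longrightarrow> (\<Sum>t\<in>T. scale (u t) (F t)) = 0 \<Longrightarrow> \<forall>t\<in>T. u t = 0"
    and span: "PS.span (F ` S) = V"
  shows "is_basis_family F S V"
proof -
  have inj: "inj_on F S"
  proof (rule inj_onI, rule ccontr)
    fix s t assume st: "s \<in> S" "t \<in> S" "F s = F t" "s \<noteq> t"
    then have "(\<Sum>x\<in>{s, t}. scale (if x = s then 1 else - 1) (F x)) = 0" by simp
    then show False using indep[of "{s, t}" "\<lambda>x. if x = s then 1 else - 1"] st by auto
  qed
  have "PS.independent (F ` S)"
    unfolding PS.dependent_explicit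
  proof safe
    fix T u v assume T: "finite T" "T \<subseteq> F ` S" "(\<Sum>v\<in>T. scale (u v) v) = 0" "v \<in> T" "u v \<noteq> 0"
    obtain U where U: "U \<subseteq> S" "T = F ` U" using iffD1[OF subset_image_iff T(2)] by blast
    have injU: "inj_on F U" using inj U(1) by (rule inj_on_subset)
    have "finite U" using T(1) injU U(2) by (simp add: finite_image_iff)
    moreover have "(\<Sum>t\<in>U. scale (u (F t)) (F t)) = 0"
      using T(3) by (simp add: U(2) sum.reindex[OF injU])
    ultimately have "\<forall>t\<in>U. u (F t) = 0" using indep[of U "\<lambda>t. u (F t)"] U(1) by simp
    then show False using T(4,5) unfolding U(2) by blast
  qed
  then show ?thesis using inj span by (simp add: is_basis_family_def)
qed

lemma ext_peak_algebra_eq_span: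
  assumes "p \<ge> 1"
  shows "PS.span ((\<lambda>(n, I). ext_peak_fun p n I) ` {(n, I). ext_peak_set p n I}) = ext_peak_algebra p"
    (is "PS.span ?B = _")
proof
  show "PS.span ?B \<subseteq> ext_peak_algebra p"
    unfolding ext_peak_algebra_def by (rule PS.span_mono) (auto simp: ext_peak_set_def)
  show "ext_peak_algebra p \<subseteq> PS.span ?B"
    unfolding ext_peak_algebra_def
    by (rule PS.span_minimal) (use ext_peak_fun_in_span[OF assms] in \<open>auto simp: PS.subspace_span\<close>)
qed

text \<open>
  The functions are homogeneous, so a linear relation splits into its degrees.
\<close>

lemma ext_peak_fun_family_independent:
  assumes p: "p \<ge> 1" and T: "finite T" "T \<subseteq> {(n, I). ext_peak_set p n I}"
    and rel: "(\<Sum>t\<in>T. scale (u t) (case t of (n, I) \<Rightarrow> ext_peak_fun p n I)) = 0"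
  shows "\<forall>t\<in>T. u t = 0"
proof
  fix t assume "t \<in> T"
  then obtain n J where t: "t = (n, J)" "(n, J) \<in> T" by (cases t) auto
  define a where "a I = (if (n, I) \<in> T then u (n, I) else 0)" for I
  have "a J = 0"
  proof (rule ext_peak_fun_coeffs_independent[OF p, of n])
    show "a I = 0" if "\<not> ext_peak_set p n I" for I using that T(2) by (auto simp: a_def)
  next
    fix M
    have coeff_zero: "coeff (ext_peak_fun p m I) M = 0" if "m \<noteq> size M" for m I
      using that by (simp add: ext_peak_fun_def coeff_qfund_size)
    show "(\<Sum>I\<in>Pow {1..<n}. a I * coeff (ext_peak_fun p n I) M) = 0"
    proof (cases "size M = n")
      case True
      have "0 = coeff (\<Sum>t\<in>T. scale (u t) (case t of (n, I) \<Rightarrow> ext_peak_fun p n I)) M"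
        by (simp add: rel zero_power_series.rep_eq)
      also have "\<dots> = (\<Sum>t\<in>T. u t * coeff (ext_peak_fun p (fst t) (snd t)) M)"
        by (simp add: coeff_sum coeff_scale split_def)
      also have "\<dots> = (\<Sum>t\<in>{t \<in> T. fst t = n}. u t * coeff (ext_peak_fun p (fst t) (snd t)) M)"
        using T(1) coeff_zero True by (intro sum.mono_neutral_right) auto
      also have "\<dots> = (\<Sum>I\<in>{I. (n, I) \<in> T}. u (n, I) * coeff (ext_peak_fun p n I) M)"
        by (rule sum.reindex_bij_witness[of _ "Pair n" snd]) auto
      also have "\<dots> = (\<Sum>I\<in>{I. (n, I) \<in> T}. a I * coeff (ext_peak_fun p n I) M)"
        by (simp add: a_def)
      also have "\<dots> = (\<Sum>I\<in>Pow {1..<n}. a I * coeff (ext_peak_fun p n I) M)"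
        using T(2) by (intro sum.mono_neutral_left) (auto simp: a_def ext_peak_set_def)
      finally show ?thesis by simp
    qed (simp add: coeff_zero)
  qed
  then show "u t = 0" using t by (simp add: a_def)
qed

lemma ext_peak_algebra_subset_QSym: "ext_peak_algebra p \<subseteq> QSym"
  unfolding ext_peak_algebra_def
  by (rule PS.span_minimal) (auto simp: ext_peak_fun_def qfund_in_QSym subspace_QSym)

lemma is_subalgebra_ext_peak_algebra: "is_subalgebra (ext_peak_algebra p)"
proof -
  let ?B = "{ext_peak_fun p n I | n I. I \<subseteq> {1..<n}}"
  have "f * g \<in> PS.span ?B" if fg: "f \<in> ?B" "g \<in> ?B" for f g
  proof -
    obtain m I n J where f: "f = ext_peak_fun p m I" "I \<subseteq> {1..<m}"
      and g: "g = ext_peak_fun p n J" "J \<subseteq> {1..<n}" using fg by blast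
    obtain u where u: "length u = m" "descents u = I"
      using exists_word_with_descents[OF finite.emptyI f(2)] by blast
    obtain v where v: "length v = n" "set v \<inter> set u = {}" "descents v = J"
      using exists_word_with_descents[OF finite_set g(2), of u] by blast
    have "f * g = word_qfund (rho p) u * word_qfund (rho p) v"
      using f g u v by (simp add: ext_peak_fun_def word_qfund_def)
    also have "\<dots> = (\<Sum>t\<in>shuffles u v. word_qfund (rho p) t)"
      using v(2) by (intro word_qfund_mult) blast
    also have "\<dots> \<in> PS.span ?B"
    proof (rule PS.span_sum)
      fix t
      have "descents t \<subseteq> {1..<length t}" by (auto simp: descents_def)
      then show "word_qfund (rho p) t \<in> PS.span ?B"
        by (intro PS.span_base) (auto simp: word_qfund_def ext_peak_fun_def)
    qed
    finally show ?thesis .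
  qed
  then have "f * g \<in> ext_peak_algebra p" if "f \<in> ext_peak_algebra p" "g \<in> ext_peak_algebra p" for f g
    using that unfolding ext_peak_algebra_def by (rule span_mult_closed)
  moreover have "1 \<in> ext_peak_algebra p"
  proof -
    have "1 = ext_peak_fun p 0 {}" by (simp add: ext_peak_fun_def qfund_0)
    then show ?thesis unfolding ext_peak_algebra_def by (intro PS.span_base) auto
  qed
  ultimately show ?thesis by (simp add: is_subalgebra_def ext_peak_algebra_def PS.subspace_span)
qed

theorem theorem3:
  fixes p :: nat
  assumes "p \<ge> 1"
  shows "ext_peak_algebra p \<subseteq> QSym \<and>
    is_subalgebra (ext_peak_algebra p) \<and>
    is_basis_family (\<lambda>(n, I). ext_peak_fun p n I) {(n, I). ext_peak_set p n I}
      (ext_peak_algebra p)"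
proof (intro conjI)
  show "is_basis_family (\<lambda>(n, I). ext_peak_fun p n I) {(n, I). ext_peak_set p n I} (ext_peak_algebra p)"
    by (rule is_basis_familyI[OF ext_peak_fun_family_independent[OF assms] ext_peak_algebra_eq_span[OF assms]])
qed (rule ext_peak_algebra_subset_QSym is_subalgebra_ext_peak_algebra)+

end
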